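(* Let $m_0,m_1$ be integers with $2\leq m_0\leq 5$ and $m_0\leq m_1$. For each $k\in\mathbb{N}$ there exists a solution of the $(m_0,m_1)$-BVP with nodal number $k$.
   Context: For positive integers $m_0,m_1$, the $(m_0,m_1)$-ODE for a function $r:(0,\tfrac{\pi}{2})\to\mathbb{R}$ is $$\ddot r(t)=\left((m_1-m_0)\csc 2t-(m_0+m_1)\cot 2t\right)\dot r(t)-m_1\frac{\sin 2r(t)}{2\cos^2 t}+m_0\frac{\sin 2r(t)}{2\sin^2 t}.$$ A solution of the $(m_0,m_1)$-BVP is a solution $r$ of the $(m_0,m_1)$-ODE with $r(0)=0$ and $r(\tfrac{\pi}{2})=(2\ell+1)\tfrac{\pi}{2}$ for some $\ell\in\mathbb{Z}$, the boundary values being understood as limits as $t\to 0$ and $t\to\tfrac{\pi}{2}$. The nodal number of $r$ is the number of $t\in(0,\tfrac{\pi}{2})$ with $r(t)=\tfrac{\pi}{2}$. Here $\mathbb{N}=\{1,2,3,\dots\}$. *)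

theory Defs
  imports "HOL-Analysis.Analysis"
begin

text \<open>
  Functions on the open interval from \<open>0\<close> to \<open>pi / 2\<close> are represented by total functions on the
  reals; every notion below depends only on the values in that interval.
\<close>

definition csc :: "real \<Rightarrow> real" where
  "csc x = 1 / sin x"

definition ode_rhs :: "nat \<Rightarrow> nat \<Rightarrow> real \<Rightarrow> real \<Rightarrow> real \<Rightarrow> real" where
  "ode_rhs m0 m1 t x v =
     ((real m1 - real m0) * csc (2 * t) - (real m0 + real m1) * cot (2 * t)) * v
     - real m1 * (sin (2 * x) / (2 * (cos t)\<^sup>2))
     + real m0 * (sin (2 * x) / (2 * (sin t)\<^sup>2))"

definition ode_solution :: "nat \<Rightarrow> nat \<Rightarrow> (real \<Rightarrow> real) \<Rightarrow> bool" where
  "ode_solution m0 m1 r \<longleftrightarrow>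
     (\<forall>t\<in>{0<..<pi / 2}.
        (r has_real_derivative deriv r t) (at t) \<and>
        (deriv r has_real_derivative ode_rhs m0 m1 t (r t) (deriv r t)) (at t))"

definition bvp_solution :: "nat \<Rightarrow> nat \<Rightarrow> (real \<Rightarrow> real) \<Rightarrow> bool" where
  "bvp_solution m0 m1 r \<longleftrightarrow>
     ode_solution m0 m1 r \<and>
     (r \<longlongrightarrow> 0) (at_right 0) \<and>
     (\<exists>l::int. (r \<longlongrightarrow> (2 * real_of_int l + 1) * (pi / 2)) (at_left (pi / 2)))"

text \<open>
  The nodal number is rendered as a relation, since \<open>card\<close> would give \<open>0\<close> for infinitely many
  nodes.
\<close>

definition has_nodal_number :: "(real \<Rightarrow> real) \<Rightarrow> nat \<Rightarrow> bool" where
  "has_nodal_number r k \<longleftrightarrow>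
     finite {t \<in> {0<..<pi / 2}. r t = pi / 2} \<and> card {t \<in> {0<..<pi / 2}. r t = pi / 2} = k"

end

theory Submission
  imports Defs "HOL-Real_Asymp.Real_Asymp"
begin

text \<open>
  In the variable \<open>x = ln (tan t)\<close> the equation is that of a pendulum,
  \<open>r'' = - ((m0 - 1) (cos t)\<^sup>2 - (m1 - 1) (sin t)\<^sup>2) r' + (m0 (cos t)\<^sup>2 - m1 (sin t)\<^sup>2) sin (2 r) / 2\<close>,
  with bounded coefficients. For \<open>x\<close> near minus infinity it has positive friction, \<open>0\<close> is a saddle and
  \<open>pi / 2\<close> attracts. For \<open>x\<close> near plus infinity the friction is negative and the odd multiples of
  \<open>pi / 2\<close> are the saddles. The solutions leaving \<open>0\<close> form a family indexed by the initial slope \<open>v\<close>,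
  and the problem is to choose \<open>v\<close> such that the solution ends in a saddle after passing \<open>pi / 2\<close>
  exactly \<open>k\<close> times.

  The family is normalised by a translation of \<open>x\<close>: with \<open>v = \<epsilon> / q\<close> for a fixed small \<open>\<epsilon>\<close> and the
  variable \<open>z = tan t / q\<close>, every solution has the form \<open>z u\<close> with \<open>u 0 = \<epsilon>\<close>, and the parameter
  \<open>q = 0\<close>, that is \<open>v = \<infinity>\<close>, is included. The equation for \<open>u\<close> is a fixed-point equation, solved on
  the whole line by a contraction in a weighted space of functions of \<open>(q, z)\<close>
  (\<open>picard_contraction\<close>, \<open>picard_fixed_exists\<close>); continuity in the parameter comes with it. At
  \<open>q = \<epsilon>\<close> the solution is \<open>r t = t\<close>, which has no nodes (\<open>f_eps\<close>). At \<open>q = 0\<close> the equation is an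
  autonomous damped pendulum converging to \<open>pi / 2\<close>, and since \<open>(m0 - 1)\<^sup>2 < 4 m0\<close> for \<open>m0 \<le> 5\<close> it
  oscillates forever (\<open>infinite_nodes_0\<close>). All nodes are simple (\<open>node_simple\<close>), so they persist
  under small changes of \<open>q\<close>, and the number of nodes is unbounded as \<open>q\<close> tends to \<open>0\<close>.

  At the far end a suitable energy increases. As soon as it is positive, the solution runs off to
  infinity monotonically; if it is never positive, the solution converges to a saddle
  (\<open>converges_if_tail_energy_nonpos\<close>). In both cases there is at most one node in the tail. Hence the
  number of nodes is lower semicontinuous in \<open>q\<close>, exceeds its value at a point by at most one
  nearby, and is upper semicontinuous wherever the solution does not converge to a saddle. At the
  infimum of the parameters with at most \<open>k\<close> nodes it must therefore be equal to \<open>k\<close>, and the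
  solution must converge to a saddle (\<open>exists_parameter\<close>).
\<close>

section \<open>Primitives as integrals over a fixed interval\<close>

text \<open>
  The variable upper limit is moved into the integrand, so that the integral makes sense for both
  signs of \<open>z\<close> and depends continuously on further parameters by the theorem on integrals over a
  fixed interval.
\<close>

lemma scaled_integral_has_derivative:
  fixes h :: "real \<Rightarrow> real"
  assumes "continuous_on UNIV h"
  shows "((\<lambda>z. integral {0..1} (\<lambda>s. z * h (z * s))) has_real_derivative h z) (at z)"
proof -
  define c where "c = \<bar>z\<bar> + 1"
  have "continuous_on {-c..c} h" using assms continuous_on_subset by blast
  then obtain H where H: "\<And>x. x \<in> {-c..c} \<Longrightarrow> (H has_vector_derivative h x) (at x within {-c..c})"
    using antiderivative_continuous by blast
  have H': "(H has_real_derivative h x) (at x)" if "\<bar>x\<bar> < c" for x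
  proof -
    have "x \<in> interior {-c..c}" using that by (simp add: abs_less_iff)
    then show ?thesis
      using H[of x] that at_within_interior[of x "{-c..c}"]
      by (auto simp: has_real_derivative_iff_has_vector_derivative abs_less_iff)
  qed
  have eq: "integral {0..1} (\<lambda>s. y * h (y * s)) = H y - H 0" if y: "\<bar>y\<bar> < c" for y
  proof -
    have "((\<lambda>s. y * h (y * s)) has_integral H (y * 1) - H (y * 0)) {0..1}"
    proof (rule fundamental_theorem_of_calculus)
      fix s :: real assume s: "s \<in> {0..1}"
      have "\<bar>y * s\<bar> \<le> \<bar>y\<bar>" using s by (simp add: abs_mult mult_left_le)
      then have "\<bar>y * s\<bar> < c" using y by linarith
      then have "((\<lambda>s. H (y * s)) has_real_derivative y * h (y * s)) (at s)"
        using DERIV_chain2[OF H'[of "y * s"] DERIV_cmult_Id[of y s]]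
        by (simp add: mult.commute)
      then show "((\<lambda>s. H (y * s)) has_vector_derivative y * h (y * s)) (at s within {0..1})"
        by (simp add: has_real_derivative_iff_has_vector_derivative has_vector_derivative_at_within)
    qed simp
    then have "integral {0..1} (\<lambda>s. y * h (y * s)) = H (y * 1) - H (y * 0)" by (rule integral_unique)
    then show ?thesis by simp
  qed
  have "((\<lambda>y. H y - H 0) has_real_derivative h z) (at z)"
    using H'[of z] by (auto intro!: derivative_eq_intros simp: c_def)
  then show ?thesis
  proof (rule has_field_derivative_transform_within_open[where S="{-c<..<c}"])
    show "z \<in> {-c<..<c}" by (auto simp: c_def)
  next
    fix y assume "y \<in> {-c<..<c}"
    then have "\<bar>y\<bar> < c" by auto
    then show "H y - H 0 = integral {0..1} (\<lambda>s. y * h (y * s))" by (rule eq[symmetric])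
  qed auto
qed

lemma scaled_integral_unique:
  fixes h Y :: "real \<Rightarrow> real"
  assumes "continuous_on UNIV h" "continuous_on UNIV Y"
    and "\<And>z. z \<noteq> 0 \<Longrightarrow> (Y has_real_derivative h z) (at z)"
  shows "Y z = Y 0 + integral {0..1} (\<lambda>s. z * h (z * s))"
proof -
  let ?I = "\<lambda>z. integral {0..1} (\<lambda>s. z * h (z * s))"
  have I: "(?I has_real_derivative h z) (at z)" for z
    by (rule scaled_integral_has_derivative[OF assms(1)])
  have "Y z - ?I z = Y 0"
  proof (rule has_derivative_zero_unique_strong_convex[where S=UNIV and K="{0}" and c=0
        and f="\<lambda>z. Y z - ?I z" and x=z])
    have "continuous_on UNIV ?I"
      using I by (meson DERIV_isCont continuous_at_imp_continuous_on)
    then show "continuous_on UNIV (\<lambda>z. Y z - ?I z)"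
      using assms(2) by (intro continuous_intros)
    fix x :: real assume "x \<in> UNIV - {0}"
    then have "((\<lambda>z. Y z - ?I z) has_real_derivative 0) (at x)"
      using DERIV_diff[OF assms(3) I, of x] by auto
    then show "((\<lambda>z. Y z - ?I z) has_derivative (\<lambda>h. 0)) (at x within UNIV)"
      unfolding has_field_derivative_def lambda_zero by simp
  qed auto
  then show ?thesis by simp
qed

section \<open>Second-order equations on the line\<close>

text \<open>
  Gronwall for \<open>G = y\<^sup>2 + y'\<^sup>2\<close>: the bound gives \<open>\<bar>G'\<bar> \<le> M G\<close>, so \<open>exp (- M x) G x\<close> decreases and
  \<open>exp (M x) G x\<close> increases, and a zero of \<open>G\<close> spreads in both directions.
\<close>

lemma second_order_zero_data_imp_zero:
  fixes y y' y'' :: "real \<Rightarrow> real"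
  assumes y: "\<And>x. (y has_real_derivative y' x) (at x)"
    and y': "\<And>x. (y' has_real_derivative y'' x) (at x)"
    and bound: "\<And>x. \<bar>y'' x\<bar> \<le> K * (\<bar>y x\<bar> + \<bar>y' x\<bar>)"
    and "0 \<le> K" and z: "y z = 0" "y' z = 0"
  shows "y x = 0"
proof -
  define G where "G x = (y x)\<^sup>2 + (y' x)\<^sup>2" for x
  define G' where "G' x = 2 * y x * y' x + 2 * y' x * y'' x" for x
  define M where "M = 1 + 3 * K"
  have G: "(G has_real_derivative G' x) (at x)" for x
    unfolding G_def G'_def by (auto intro!: derivative_eq_intros y y')
  have G'_le: "\<bar>G' x\<bar> \<le> M * G x" for x
  proof -
    let ?a = "\<bar>y x\<bar>" and ?b = "\<bar>y' x\<bar>"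
    have sq: "2 * ?a * ?b \<le> ?a\<^sup>2 + ?b\<^sup>2" by (rule sum_squares_bound)
    have "\<bar>G' x\<bar> \<le> 2 * ?a * ?b + 2 * ?b * \<bar>y'' x\<bar>"
      unfolding G'_def by (rule order_trans[OF abs_triangle_ineq]) (simp add: abs_mult)
    also have "\<dots> \<le> 2 * ?a * ?b + 2 * ?b * (K * (?a + ?b))"
      using bound by (intro add_left_mono mult_left_mono) auto
    also have "\<dots> = (2 * ?a * ?b) + K * (2 * ?a * ?b) + 2 * K * ?b\<^sup>2"
      by (simp add: algebra_simps power2_eq_square)
    also have "\<dots> \<le> (?a\<^sup>2 + ?b\<^sup>2) + K * (?a\<^sup>2 + ?b\<^sup>2) + 2 * K * (?a\<^sup>2 + ?b\<^sup>2)"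
      using sq \<open>0 \<le> K\<close> by (intro add_mono mult_left_mono) auto
    also have "\<dots> = M * G x" by (simp add: G_def M_def algebra_simps)
    finally show ?thesis .
  qed
  have Gz: "G z = 0" by (simp add: G_def z)
  have "G x \<le> 0"
  proof (cases "z \<le> x")
    case True
    have "(\<lambda>x. exp (- M * x) * G x) x \<le> (\<lambda>x. exp (- M * x) * G x) z"
    proof (rule DERIV_nonpos_imp_nonincreasing[OF True])
      fix s
      have "((\<lambda>x. exp (- M * x) * G x) has_real_derivative exp (- M * s) * (G' s - M * G s)) (at s)"
        by (auto intro!: derivative_eq_intros G simp: algebra_simps)
      moreover have "exp (- M * s) * (G' s - M * G s) \<le> 0"
        using G'_le[of s] by (intro mult_nonneg_nonpos) auto
      ultimately show "\<exists>y. ((\<lambda>x. exp (- M * x) * G x) has_real_derivative y) (at s) \<and> y \<le> 0" by blast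
    qed
    then show ?thesis using Gz by (simp add: mult_le_0_iff)
  next
    case False
    then have "x \<le> z" by simp
    then have "(\<lambda>x. exp (M * x) * G x) x \<le> (\<lambda>x. exp (M * x) * G x) z"
    proof (rule DERIV_nonneg_imp_nondecreasing)
      fix s
      have "((\<lambda>x. exp (M * x) * G x) has_real_derivative exp (M * s) * (G' s + M * G s)) (at s)"
        by (auto intro!: derivative_eq_intros G simp: algebra_simps)
      moreover have "exp (M * s) * (G' s + M * G s) \<ge> 0"
        using G'_le[of s] by (intro mult_nonneg_nonneg) auto
      ultimately show "\<exists>y. ((\<lambda>x. exp (M * x) * G x) has_real_derivative y) (at s) \<and> y \<ge> 0" by blast
    qed
    then show ?thesis using Gz by (simp add: mult_le_0_iff)
  qed
  then show ?thesis unfolding G_def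
    by (smt (verit) zero_le_power2 zero_eq_power2)
qed

text \<open>
  Barbalat's lemma. Whenever \<open>h\<close> reaches a height \<open>e\<close> it stays above \<open>e / 2\<close> on an interval whose
  length depends only on \<open>e\<close> and \<open>K\<close>, so \<open>J\<close> grows by a fixed amount; a bounded \<open>J\<close> allows this only
  finitely often.
\<close>

lemma lipschitz_dissipation_vanishes:
  fixes J J' h :: "real \<Rightarrow> real"
  assumes J: "\<And>x. x \<ge> X \<Longrightarrow> (J has_real_derivative J' x) (at x)"
    and hJ: "\<And>x. x \<ge> X \<Longrightarrow> h x \<le> J' x"
    and h0: "\<And>x. x \<ge> X \<Longrightarrow> 0 \<le> h x"
    and B: "\<And>x. x \<ge> X \<Longrightarrow> J x \<le> B"
    and lip: "\<And>x y. X \<le> x \<Longrightarrow> x \<le> y \<Longrightarrow> \<bar>h y - h x\<bar> \<le> K * (y - x)" and K: "K > 0"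
  shows "(h \<longlongrightarrow> 0) at_top"
proof -
  have inc: "J x + c * (y - x) \<le> J y"
    if "X \<le> x" "x \<le> y" and c: "\<And>s. x \<le> s \<Longrightarrow> s \<le> y \<Longrightarrow> c \<le> h s" for x y c
  proof -
    have "(\<lambda>s. J s - c * s) x \<le> (\<lambda>s. J s - c * s) y"
    proof (rule DERIV_nonneg_imp_nondecreasing[OF \<open>x \<le> y\<close>])
      fix s assume s: "x \<le> s" "s \<le> y"
      then have "((\<lambda>s. J s - c * s) has_real_derivative J' s - c) (at s)"
        using \<open>X \<le> x\<close> by (auto intro!: derivative_eq_intros J)
      moreover have "0 \<le> J' s - c" using s hJ[of s] c[of s] \<open>X \<le> x\<close> by linarith
      ultimately show "\<exists>y. ((\<lambda>s. J s - c * s) has_real_derivative y) (at s) \<and> y \<ge> 0" by blast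
    qed
    then show ?thesis by (simp add: algebra_simps)
  qed
  have bdd: "bdd_above (J ` {X..})" using B by (auto intro!: bdd_aboveI)
  define S where "S = Sup (J ` {X..})"
  have JS: "J x \<le> S" if "X \<le> x" for x
    unfolding S_def using that by (intro cSup_upper bdd) auto
  show ?thesis
  proof (rule tendstoI)
    fix e :: real assume e: "e > 0"
    define d where "d = e / (2 * K)"
    have d: "d > 0" "K * d = e / 2" using e K by (auto simp: d_def)
    have "S - d * (e / 2) < Sup (J ` {X..})" using d e by (simp add: S_def)
    then obtain a where a: "X \<le> a" "S - d * (e / 2) < J a"
      using less_cSup_iff[OF _ bdd] by auto
    have "dist (h x) 0 < e" if x: "x \<ge> a" for x
    proof (rule ccontr)
      assume "\<not> dist (h x) 0 < e"
      then have hx: "h x \<ge> e" using h0[of x] x a by (simp add: dist_real_def)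
      have "J x + (e / 2) * ((x + d) - x) \<le> J (x + d)"
      proof (rule inc)
        fix s assume s: "x \<le> s" "s \<le> x + d"
        have "\<bar>h s - h x\<bar> \<le> K * (s - x)" using lip[of x s] s x a by auto
        also have "\<dots> \<le> K * d" using s K by (intro mult_left_mono) auto
        finally show "e / 2 \<le> h s" using hx d by linarith
      qed (use x a d in auto)
      moreover have "J a \<le> J x" using inc[of a x 0] h0 x a by auto
      moreover have "J (x + d) \<le> S" using JS[of "x + d"] x a d by auto
      ultimately show False using a by (simp add: mult.commute)
    qed
    then show "\<forall>\<^sub>F x in at_top. dist (h x) 0 < e"
      unfolding eventually_at_top_linorder by blast
  qed
qed

text \<open>
  If a Lyapunov function \<open>V\<close> of a pendulum equation controls only the velocity, then adding the
  virial term \<open>y' sin (2 y)\<close> to a large multiple of it also controls the torque \<open>sin (2 y)\<close>. The friction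
  may have either sign: the lemma is applied to a damped pendulum, with \<open>V\<close> the negative of
  the energy, and to one with negative friction, with \<open>V\<close> the energy.
\<close>

lemma pendulum_settles:
  fixes y y' \<beta> A V V' :: "real \<Rightarrow> real"
  assumes y: "\<And>x. x \<ge> X \<Longrightarrow> (y has_real_derivative y' x) (at x)"
    and y': "\<And>x. x \<ge> X \<Longrightarrow> (y' has_real_derivative - \<beta> x * y' x + A x / 2 * sin (2 * y x)) (at x)"
    and A: "\<And>x. x \<ge> X \<Longrightarrow> A0 \<le> A x" "\<And>x. x \<ge> X \<Longrightarrow> A x \<le> A1" "A0 > 0"
    and \<beta>: "\<And>x. x \<ge> X \<Longrightarrow> \<bar>\<beta> x\<bar> \<le> B"
    and W: "\<And>x. x \<ge> X \<Longrightarrow> \<bar>y' x\<bar> \<le> W"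
    and V: "\<And>x. x \<ge> X \<Longrightarrow> (V has_real_derivative V' x) (at x)"
    and V': "\<And>x. x \<ge> X \<Longrightarrow> \<gamma> * (y' x)\<^sup>2 \<le> V' x" "\<gamma> > 0"
    and Vmax: "\<And>x. x \<ge> X \<Longrightarrow> V x \<le> Vmax"
  shows "(y' \<longlongrightarrow> 0) at_top" "((\<lambda>x. sin (2 * y x)) \<longlongrightarrow> 0) at_top"
proof -
  have B0: "0 \<le> B" using \<beta>[of X] by auto
  have W0: "0 \<le> W" using W[of X] by auto
  have A01: "A0 \<le> A1" using A(1,2)[of X] by auto
  define h where "h x = A0 / 4 * (sin (2 * y x))\<^sup>2 + (y' x)\<^sup>2" for x
  \<comment> \<open>large enough to absorb the velocity terms \<open>B\<^sup>2 / A0\<close> and \<open>2\<close> from the virial term, leaving \<open>1\<close>\<close>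
  define c where "c = (B\<^sup>2 / A0 + 3) / \<gamma>"
  have c: "c \<ge> 0" using A(3) V'(2) by (simp add: c_def)
  define y'' where "y'' x = - \<beta> x * y' x + A x / 2 * sin (2 * y x)" for x
  define J where "J x = y' x * sin (2 * y x) + c * V x" for x
  define J' where "J' x = y'' x * sin (2 * y x) + 2 * (y' x)\<^sup>2 * cos (2 * y x) + c * V' x" for x
  define h' where "h' x = A0 * sin (2 * y x) * cos (2 * y x) * y' x + 2 * y' x * y'' x" for x
  have y'': "(y' has_real_derivative y'' x) (at x)" if "x \<ge> X" for x
    using y'[OF that] by (simp add: y''_def)
  have y''_le: "\<bar>y'' x\<bar> \<le> B * W + A1 / 2" if x: "x \<ge> X" for x
  proof -
    have "\<bar>y'' x\<bar> \<le> \<bar>\<beta> x\<bar> * \<bar>y' x\<bar> + \<bar>A x / 2\<bar> * \<bar>sin (2 * y x)\<bar>"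
      unfolding y''_def by (rule order_trans[OF abs_triangle_ineq]) (simp add: abs_mult)
    also have "\<dots> \<le> B * W + (A1 / 2) * 1"
      using \<beta>[OF x] W[OF x] A(1,2)[OF x] A(3) B0 by (intro add_mono mult_mono) auto
    finally show ?thesis by simp
  qed
  have "(h \<longlongrightarrow> 0) at_top"
  proof (rule lipschitz_dissipation_vanishes[where X=X and J=J and J'=J' and B="W + c * Vmax"
        and K="A0 * W + 2 * (W * (B * W + A1 / 2)) + 1"])
    fix x assume x: "x \<ge> X"
    show "(J has_real_derivative J' x) (at x)"
      unfolding J_def J'_def
      by (auto intro!: derivative_eq_intros y y'' V x simp: power2_eq_square)
    show "0 \<le> h x" using A(3) by (simp add: h_def)
    have "\<bar>y' x * sin (2 * y x)\<bar> \<le> W * 1"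
      unfolding abs_mult using W[OF x] W0 by (intro mult_mono) auto
    moreover have "c * V x \<le> c * Vmax" using c Vmax[OF x] by (intro mult_left_mono)
    ultimately show "J x \<le> W + c * Vmax" unfolding J_def by linarith
    show "h x \<le> J' x"
    proof -
      define S where "S = sin (2 * y x)"
      define p where "p = y' x"
      have "0 \<le> (A0 / 2 * \<bar>S\<bar> - B * \<bar>p\<bar>)\<^sup>2" by simp
      also have "\<dots> = A0 * (A0 / 4 * S\<^sup>2 - B * \<bar>p\<bar> * \<bar>S\<bar> + B\<^sup>2 / A0 * p\<^sup>2)"
        using A(3) by (simp add: power2_diff power_mult_distrib power_divide)
          (simp add: algebra_simps power2_eq_square)
      finally have 1: "B * \<bar>p\<bar> * \<bar>S\<bar> \<le> A0 / 4 * S\<^sup>2 + B\<^sup>2 / A0 * p\<^sup>2"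
        using A(3) by (simp add: zero_le_mult_iff)
      have "\<bar>\<beta> x * p * S\<bar> \<le> B * \<bar>p\<bar> * \<bar>S\<bar>"
        unfolding abs_mult using \<beta>[OF x] by (intro mult_mono) auto
      then have 2: "- \<beta> x * p * S \<ge> - (A0 / 4 * S\<^sup>2) - B\<^sup>2 / A0 * p\<^sup>2" using 1 by linarith
      have 3: "A x / 2 * S\<^sup>2 \<ge> A0 / 2 * S\<^sup>2"
        using A(1)[OF x] by (intro mult_right_mono) auto
      have 4: "2 * p\<^sup>2 * cos (2 * y x) \<ge> 2 * p\<^sup>2 * (-1)"
        by (intro mult_left_mono) auto
      have "c * (\<gamma> * p\<^sup>2) \<le> c * V' x" using V'(1)[OF x] c by (intro mult_left_mono) (auto simp: p_def)
      moreover have "c * (\<gamma> * p\<^sup>2) = B\<^sup>2 / A0 * p\<^sup>2 + 3 * p\<^sup>2"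
        using V'(2) by (simp add: c_def field_simps)
      ultimately have 5: "c * V' x \<ge> B\<^sup>2 / A0 * p\<^sup>2 + 3 * p\<^sup>2" by simp
      have "J' x = - \<beta> x * p * S + A x / 2 * S\<^sup>2 + 2 * p\<^sup>2 * cos (2 * y x) + c * V' x"
        unfolding J'_def y''_def S_def p_def by (simp add: algebra_simps power2_eq_square)
      then have "A0 / 4 * S\<^sup>2 + p\<^sup>2 \<le> J' x" using 2 3 4 5 by linarith
      then show ?thesis by (simp add: h_def S_def p_def)
    qed
  next
    let ?K = "A0 * W + 2 * (W * (B * W + A1 / 2))"
    fix x z assume xz: "X \<le> x" "x \<le> z"
    have dh: "(h has_real_derivative h' s) (at s)" if "s \<ge> X" for s
      unfolding h_def h'_def
      by (auto intro!: derivative_eq_intros y y'' that simp: power2_eq_square)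
    have h'_le: "\<bar>h' s\<bar> \<le> ?K" if s: "s \<ge> X" for s
    proof -
      have "\<bar>h' s\<bar> \<le> A0 * (\<bar>sin (2 * y s)\<bar> * \<bar>cos (2 * y s)\<bar>) * \<bar>y' s\<bar> + 2 * (\<bar>y' s\<bar> * \<bar>y'' s\<bar>)"
        unfolding h'_def by (rule order_trans[OF abs_triangle_ineq]) (use A(3) in \<open>simp add: abs_mult\<close>)
      also have "\<dots> \<le> A0 * (1 * 1) * W + 2 * (W * (B * W + A1 / 2))"
        using A(3) W[OF s] W0 y''_le[OF s] by (intro add_mono mult_mono mult_left_mono) auto
      finally show ?thesis by simp
    qed
    have "norm (h z - h x) \<le> ?K * norm (z - x)"
      by (rule field_differentiable_bound[where S="{x..z}" and f'=h'])
        (use xz dh h'_le in \<open>auto intro: has_field_derivative_at_within\<close>)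
    then show "\<bar>h z - h x\<bar> \<le> (?K + 1) * (z - x)" using xz by (simp add: algebra_simps)
  next
    show "A0 * W + 2 * (W * (B * W + A1 / 2)) + 1 > 0"
      using A(3) A01 W0 B0 by (smt (verit) mult_nonneg_nonneg divide_nonneg_nonneg)
  qed
  then have h0: "((\<lambda>x. sqrt (h x)) \<longlongrightarrow> 0) at_top" using tendsto_real_sqrt by fastforce
  have "norm (y' x) \<le> sqrt (h x)" for x
    unfolding h_def using A(3) by (simp add: real_le_rsqrt)
  then show "(y' \<longlongrightarrow> 0) at_top"
    by (intro Lim_null_comparison[OF _ h0]) auto
  have h1: "((\<lambda>x. 2 / sqrt A0 * sqrt (h x)) \<longlongrightarrow> 0) at_top"
    by (rule tendsto_mult_right_zero[OF h0])
  have "norm (sin (2 * y x)) \<le> 2 / sqrt A0 * sqrt (h x)" for x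
  proof -
    have "(sqrt A0 / 2 * \<bar>sin (2 * y x)\<bar>)\<^sup>2 \<le> h x"
      unfolding h_def using A(3) by (simp add: power_mult_distrib power_divide)
    then have "sqrt A0 / 2 * \<bar>sin (2 * y x)\<bar> \<le> sqrt (h x)" by (rule real_le_rsqrt)
    then show ?thesis using A(3) by (simp add: field_simps)
  qed
  then show "((\<lambda>x. sin (2 * y x)) \<longlongrightarrow> 0) at_top"
    by (intro Lim_null_comparison[OF _ h1]) auto
qed

text \<open>
  Without a zero the Riccati variable \<open>p = y' / y + b / 2\<close> satisfies \<open>p' \<le> - (p\<^sup>2 + \<omega>\<^sup>2)\<close>, so the angle
  \<open>arctan (p / \<omega>)\<close> decreases at least at speed \<open>\<omega>\<close>, which is impossible over an interval of length
  \<open>2 pi / \<omega>\<close>.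
\<close>

lemma underdamped_has_zero:
  fixes y y' \<kappa> :: "real \<Rightarrow> real"
  assumes y: "\<And>x. x \<ge> X \<Longrightarrow> (y has_real_derivative y' x) (at x)"
    and y': "\<And>x. x \<ge> X \<Longrightarrow> (y' has_real_derivative - b * y' x - \<kappa> x * y x) (at x)"
    and \<kappa>: "\<And>x. x \<ge> X \<Longrightarrow> \<kappa>0 \<le> \<kappa> x" and osc: "b\<^sup>2 / 4 < \<kappa>0"
  shows "\<exists>x\<ge>X. y x = 0"
proof (rule ccontr)
  assume "\<not> ?thesis"
  then have nz: "y x \<noteq> 0" if "x \<ge> X" for x using that by auto
  define \<omega> where "\<omega> = sqrt (\<kappa>0 - b\<^sup>2 / 4)"
  have \<omega>: "\<omega> > 0" "\<omega>\<^sup>2 = \<kappa>0 - b\<^sup>2 / 4" using osc by (auto simp: \<omega>_def)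
  define p where "p x = y' x / y x + b / 2" for x
  define p' where "p' x = - (y' x / y x)\<^sup>2 - b * (y' x / y x) - \<kappa> x" for x
  have p: "(p has_real_derivative p' x) (at x)" if "x \<ge> X" for x
    unfolding p_def p'_def using that nz[OF that]
    by (auto intro!: derivative_eq_intros y y' simp: field_simps power2_eq_square)
  have p'_le: "p' x \<le> - ((p x)\<^sup>2 + \<omega>\<^sup>2)" if "x \<ge> X" for x
    using \<kappa>[OF that] unfolding \<omega>(2) p_def p'_def by (simp add: power2_eq_square algebra_simps)
  define g where "g x = arctan (p x / \<omega>) + \<omega> * x" for x
  have "g (X + 2 * pi / \<omega>) \<le> g X"
  proof (rule DERIV_nonpos_imp_nonincreasing[where f=g])
    show "X \<le> X + 2 * pi / \<omega>" using \<omega> by simp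
    fix x assume "X \<le> x"
    have pos: "\<omega>\<^sup>2 + (p x)\<^sup>2 > 0" using \<omega>(1) by (simp add: add_pos_nonneg)
    have eq: "1 + (p x / \<omega>)\<^sup>2 = (\<omega>\<^sup>2 + (p x)\<^sup>2) / \<omega>\<^sup>2"
      using \<omega> by (simp add: field_simps)
    have "(g has_real_derivative (p' x / \<omega>) / (1 + (p x / \<omega>)\<^sup>2) + \<omega>) (at x)"
      unfolding g_def using \<omega> by (auto intro!: derivative_eq_intros p \<open>X \<le> x\<close> simp: field_simps)
    moreover have "(p' x / \<omega>) / (1 + (p x / \<omega>)\<^sup>2) + \<omega> = \<omega> * (p' x / (\<omega>\<^sup>2 + (p x)\<^sup>2) + 1)"
      unfolding eq using \<omega> by (simp add: field_simps power2_eq_square)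
    moreover have "p' x / (\<omega>\<^sup>2 + (p x)\<^sup>2) \<le> -1"
      using p'_le[OF \<open>X \<le> x\<close>] pos by (simp add: pos_divide_le_eq)
    ultimately show "\<exists>z. (g has_real_derivative z) (at x) \<and> z \<le> 0"
      using \<omega> by (smt (verit) mult_nonneg_nonpos)
  qed
  moreover have "\<omega> * (X + 2 * pi / \<omega>) = \<omega> * X + 2 * pi" using \<omega> by (simp add: field_simps)
  ultimately have "arctan (p (X + 2 * pi / \<omega>) / \<omega>) + 2 * pi \<le> arctan (p X / \<omega>)"
    by (simp add: g_def)
  then show False
    using arctan_lbound[of "p (X + 2 * pi / \<omega>) / \<omega>"] arctan_ubound[of "p X / \<omega>"] pi_gt_zero
    by linarith
qed

section \<open>Zeros in a one-parameter family of functions\<close>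

lemma continuous_on_nhds_close:
  fixes f :: "'a::metric_space \<Rightarrow> real"
  assumes "continuous_on S f" "p \<in> S" "e > 0"
  shows "\<exists>d>0. \<forall>q\<in>S. dist q p < d \<longrightarrow> \<bar>f q - f p\<bar> < e"
  using assms unfolding continuous_on_iff dist_real_def by blast

text \<open>
  Around each simple zero the function changes sign, and the two signs survive small changes of the
  parameter; the intervals are chosen disjoint so that different zeros produce different zeros.
\<close>

lemma simple_zeros_persist:
  fixes f f' :: "real \<Rightarrow> real \<Rightarrow> real"
  assumes cont: "continuous_on (S \<times> UNIV) (\<lambda>(q, x). f q x)"
    and der: "\<And>q x. q \<in> S \<Longrightarrow> (f q has_real_derivative f' q x) (at x)"
    and p: "p \<in> S" and T: "finite T" "\<And>z. z \<in> T \<Longrightarrow> f p z = 0 \<and> f' p z \<noteq> 0"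
  shows "\<forall>\<^sub>F q in nhds p. q \<in> S \<longrightarrow> (\<exists>T'. finite T' \<and> card T' = card T \<and> (\<forall>z\<in>T'. f q z = 0))"
proof -
  have "uniform_discrete T" using T(1) uniform_discrete_finite_iff by blast
  then obtain e where e: "e > 0" "\<And>x y. x \<in> T \<Longrightarrow> y \<in> T \<Longrightarrow> dist x y < e \<Longrightarrow> x = y"
    unfolding uniform_discrete_def by blast
  have contq: "continuous_on S (\<lambda>q. f q x)" for x
  proof -
    have "continuous_on S ((\<lambda>(q, x). f q x) \<circ> (\<lambda>q. (q, x)))"
      by (intro continuous_on_compose continuous_intros continuous_on_subset[OF cont]) auto
    then show ?thesis by (simp add: o_def)
  qed
  have loc: "\<forall>\<^sub>F q in nhds p. q \<in> S \<longrightarrow> (\<exists>w. \<bar>w - z\<bar> < e / 2 \<and> f q w = 0)" if z: "z \<in> T" for z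
  proof -
    have "\<exists>a b. a < z \<and> z < b \<and> z - a < e / 2 \<and> b - z < e / 2 \<and> f p a * f p b < 0"
    proof (cases "f' p z > 0")
      case True
      obtain d1 where d1: "d1 > 0" "\<And>h. h > 0 \<Longrightarrow> h < d1 \<Longrightarrow> f p z < f p (z + h)"
        using DERIV_pos_inc_right[OF der[OF p] True] by blast
      obtain d2 where d2: "d2 > 0" "\<And>h. h > 0 \<Longrightarrow> h < d2 \<Longrightarrow> f p (z - h) < f p z"
        using DERIV_pos_inc_left[OF der[OF p] True] by blast
      define h where "h = Min {d1, d2, e / 2} / 2"
      have h: "h > 0" "h < d1" "h < d2" "h < e / 2" using d1(1) d2(1) e(1) by (auto simp: h_def min_def)
      then have "f p (z - h) * f p (z + h) < 0"
        using d1(2)[of h] d2(2)[of h] T(2)[OF z] by (auto intro!: mult_neg_pos)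
      then show ?thesis using h by (intro exI[of _ "z - h"] exI[of _ "z + h"]) auto
    next
      case False
      then have neg: "f' p z < 0" using T(2)[OF z] by auto
      obtain d1 where d1: "d1 > 0" "\<And>h. h > 0 \<Longrightarrow> h < d1 \<Longrightarrow> f p z > f p (z + h)"
        using DERIV_neg_dec_right[OF der[OF p] neg] by blast
      obtain d2 where d2: "d2 > 0" "\<And>h. h > 0 \<Longrightarrow> h < d2 \<Longrightarrow> f p z < f p (z - h)"
        using DERIV_neg_dec_left[OF der[OF p] neg] by blast
      define h where "h = Min {d1, d2, e / 2} / 2"
      have h: "h > 0" "h < d1" "h < d2" "h < e / 2" using d1(1) d2(1) e(1) by (auto simp: h_def min_def)
      then have "f p (z - h) * f p (z + h) < 0"
        using d1(2)[of h] d2(2)[of h] T(2)[OF z] by (auto intro!: mult_pos_neg)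
      then show ?thesis using h by (intro exI[of _ "z - h"] exI[of _ "z + h"]) auto
    qed
    then obtain a b where ab: "a < z" "z < b" "z - a < e / 2" "b - z < e / 2" "f p a * f p b < 0" by blast
    have "continuous_on S (\<lambda>q. f q a * f q b)" by (intro continuous_intros contq)
    from continuous_on_nhds_close[OF this p, of "- (f p a * f p b)"] ab(5)
    obtain d where d: "d > 0" "\<And>q. q \<in> S \<Longrightarrow> dist q p < d \<Longrightarrow> \<bar>f q a * f q b - f p a * f p b\<bar> < - (f p a * f p b)"
      by auto
    have "\<exists>w. \<bar>w - z\<bar> < e / 2 \<and> f q w = 0" if q: "q \<in> S" "dist q p < d" for q
    proof -
      have neg: "f q a * f q b < 0" using d(2)[OF q] by linarith
      have cx: "continuous_on {a..b} (f q)"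
        using der[OF q(1)] by (meson DERIV_isCont continuous_at_imp_continuous_on)
      have "\<exists>w\<ge>a. w \<le> b \<and> f q w = 0"
      proof (cases "f q a < 0")
        case True
        then show ?thesis using neg ab by (intro IVT') (auto simp: mult_less_0_iff cx)
      next
        case False
        then show ?thesis using neg ab by (intro IVT2') (auto simp: mult_less_0_iff cx)
      qed
      then obtain w where "a \<le> w" "w \<le> b" "f q w = 0" by blast
      moreover from this have "\<bar>w - z\<bar> < e / 2" using ab(3,4) unfolding abs_less_iff by linarith
      ultimately show ?thesis by blast
    qed
    then show ?thesis unfolding eventually_nhds_metric using d(1) by blast
  qed
  have "\<forall>\<^sub>F q in nhds p. \<forall>z\<in>T. q \<in> S \<longrightarrow> (\<exists>w. \<bar>w - z\<bar> < e / 2 \<and> f q w = 0)"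
    by (intro eventually_ball_finite T(1) ballI loc)
  then show ?thesis
  proof (rule eventually_mono, intro impI)
    fix q assume H: "\<forall>z\<in>T. q \<in> S \<longrightarrow> (\<exists>w. \<bar>w - z\<bar> < e / 2 \<and> f q w = 0)" and "q \<in> S"
    then have "\<forall>z\<in>T. \<exists>w. \<bar>w - z\<bar> < e / 2 \<and> f q w = 0" by blast
    then obtain g where g: "\<And>z. z \<in> T \<Longrightarrow> \<bar>g z - z\<bar> < e / 2 \<and> f q (g z) = 0" by metis
    have "inj_on g T"
    proof (rule inj_onI)
      fix x y assume xy: "x \<in> T" "y \<in> T" "g x = g y"
      have "dist x y < e" using g[OF xy(1)] g[OF xy(2)] xy(3) unfolding dist_real_def by linarith
      then show "x = y" using e(2) xy by blast
    qed
    then show "\<exists>T'. finite T' \<and> card T' = card T \<and> (\<forall>z\<in>T'. f q z = 0)"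
      using T(1) g by (intro exI[of _ "g ` T"]) (auto simp: card_image)
  qed
qed

text \<open>
  Every point of the interval has a neighbourhood on which, for all parameters near \<open>p\<close>, either
  the function or its derivative does not vanish. A neighbourhood of the second kind contains at
  most one zero by Rolle, and its centre is a zero for the parameter \<open>p\<close>. Choosing finitely many of
  these neighbourhoods maps the nearby zeros injectively to the zeros for \<open>p\<close>.
\<close>

lemma zero_count_upper_semicontinuous:
  fixes f f' :: "real \<Rightarrow> real \<Rightarrow> real"
  assumes cont: "continuous_on (S \<times> UNIV) (\<lambda>(q, x). f q x)"
    and cont': "continuous_on (S \<times> UNIV) (\<lambda>(q, x). f' q x)"
    and der: "\<And>q x. q \<in> S \<Longrightarrow> (f q has_real_derivative f' q x) (at x)"
    and p: "p \<in> S" and simple: "\<And>x. f p x = 0 \<Longrightarrow> f' p x \<noteq> 0"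
  shows "finite {x \<in> {a..b}. f p x = 0}"
    and "\<forall>\<^sub>F q in nhds p. q \<in> S \<longrightarrow> finite {x \<in> {a..b}. f q x = 0} \<and>
           card {x \<in> {a..b}. f q x = 0} \<le> card {x \<in> {a..b}. f p x = 0}"
proof -
  define good where "good x e q \<longleftrightarrow>
    (\<forall>y. \<bar>y - x\<bar> < e \<longrightarrow> (f p x \<noteq> 0 \<longrightarrow> f q y \<noteq> 0) \<and> (f p x = 0 \<longrightarrow> f' q y \<noteq> 0))" for x e q
  have loc: "\<exists>e>0. \<forall>\<^sub>F q in nhds p. q \<in> S \<longrightarrow> good x e q" for x
  proof -
    define F where "F = (if f p x = 0 then (\<lambda>(q, x). f' q x) else (\<lambda>(q, x). f q x))"
    have Fc: "continuous_on (S \<times> UNIV) F" using cont cont' by (simp add: F_def)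
    have Fp: "F (p, x) \<noteq> 0" using simple by (auto simp: F_def)
    obtain d where d: "d > 0" "\<And>w. w \<in> S \<times> UNIV \<Longrightarrow> dist w (p, x) < d \<Longrightarrow> \<bar>F w - F (p, x)\<bar> < \<bar>F (p, x)\<bar>"
      using continuous_on_nhds_close[OF Fc, of "(p, x)" "\<bar>F (p, x)\<bar>"] p Fp by auto
    have "good x (d / 2) q" if q: "q \<in> S" "dist q p < d / 2" for q
    proof -
      have "F (q, y) \<noteq> 0" if "\<bar>y - x\<bar> < d / 2" for y
      proof -
        have "dist (q, y) (p, x) \<le> dist q p + dist y x"
          unfolding dist_Pair_Pair by (intro real_sqrt_sum_squares_triangle_ineq[of _ 0 0, simplified] sqrt_sum_squares_le_sum) auto
        also have "\<dots> < d" using q that by (simp add: dist_real_def)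
        finally show ?thesis using d(2)[of "(q, y)"] q by auto
      qed
      then show ?thesis unfolding good_def F_def by (auto split: if_splits)
    qed
    then have "\<forall>\<^sub>F q in nhds p. q \<in> S \<longrightarrow> good x (d / 2) q"
      using d(1) unfolding eventually_nhds_metric by (intro exI[of _ "d / 2"]) auto
    then show ?thesis using d(1) by (intro exI[of _ "d / 2"]) auto
  qed
  then obtain e where e: "\<And>x. e x > 0" "\<And>x. \<forall>\<^sub>F q in nhds p. q \<in> S \<longrightarrow> good x (e x) q" by metis
  have cover: "{a..b} \<subseteq> (\<Union>x\<in>{a..b}. ball x (e x))" using e(1) by auto
  obtain C where C: "C \<subseteq> {a..b}" "finite C" "{a..b} \<subseteq> (\<Union>x\<in>C. ball x (e x))"
    by (rule compactE_image[OF compact_Icc open_ball cover]) (rule that)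
  let ?Z = "\<lambda>q. {x \<in> {a..b}. f q x = 0}"
  have ev: "\<forall>\<^sub>F q in nhds p. \<forall>x\<in>C. q \<in> S \<longrightarrow> good x (e x) q"
    by (intro eventually_ball_finite C ballI e)
  have inj: "\<exists>g. inj_on g (?Z q) \<and> g ` ?Z q \<subseteq> {x\<in>C. f p x = 0}" if q: "q \<in> S" and gd: "\<And>x. x \<in> C \<Longrightarrow> good x (e x) q" for q
  proof -
    have "\<exists>x. x \<in> C \<and> \<bar>z - x\<bar> < e x \<and> f p x = 0" if z: "z \<in> ?Z q" for z
    proof -
      obtain x where x: "x \<in> C" "z \<in> ball x (e x)" using z C(3) by blast
      then have "\<bar>z - x\<bar> < e x" by (simp add: dist_real_def abs_minus_commute)
      then show ?thesis using gd[OF x(1)] z x(1) unfolding good_def by blast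
    qed
    then obtain g where g: "\<And>z. z \<in> ?Z q \<Longrightarrow> g z \<in> C \<and> \<bar>z - g z\<bar> < e (g z) \<and> f p (g z) = 0" by metis
    have no: False if zz: "z \<in> ?Z q" "w \<in> ?Z q" "g z = g w" "z < w" for z w
    proof -
      have "\<exists>y. z < y \<and> y < w \<and> (f q has_real_derivative 0) (at y)"
        using zz der[OF q] by (intro Rolle)
          (auto simp: real_differentiable_def intro: DERIV_isCont continuous_at_imp_continuous_on)
      then obtain y where y: "z < y" "y < w" "f' q y = 0" using DERIV_unique[OF der[OF q]] by blast
      have "\<bar>z - g z\<bar> < e (g z)" "\<bar>w - g z\<bar> < e (g z)" using g[OF zz(1)] g[OF zz(2)] zz(3) by auto
      then have "\<bar>y - g z\<bar> < e (g z)" using y(1,2) unfolding abs_less_iff by linarith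
      then show False using gd[of "g z"] g[OF zz(1)] y(3) unfolding good_def by blast
    qed
    have "inj_on g (?Z q)"
    proof (rule inj_onI, rule ccontr)
      fix z w assume zw: "z \<in> ?Z q" "w \<in> ?Z q" "g z = g w" "z \<noteq> w"
      then consider "z < w" | "w < z" by linarith
      then show False using no[OF zw(1,2,3)] no[OF zw(2,1) zw(3)[symmetric]] by cases
    qed
    then show ?thesis using g by blast
  qed
  have gdp: "good x (e x) p" if "x \<in> C" for x
    using eventually_nhds_x_imp_x[OF ev] p that by blast
  have fin: "finite {x\<in>C. f p x = 0}" using C(2) by simp
  then show "finite (?Z p)"
    using inj[OF p gdp] by (meson finite_imageD finite_subset)
  moreover have "{x\<in>C. f p x = 0} \<subseteq> ?Z p" using C(1) by auto
  ultimately have card: "card {x\<in>C. f p x = 0} \<le> card (?Z p)" by (rule card_mono)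
  show "\<forall>\<^sub>F q in nhds p. q \<in> S \<longrightarrow> finite (?Z q) \<and> card (?Z q) \<le> card (?Z p)"
    using ev
  proof (rule eventually_mono, intro impI)
    fix q assume H: "\<forall>x\<in>C. q \<in> S \<longrightarrow> good x (e x) q" and q: "q \<in> S"
    then obtain g where g: "inj_on g (?Z q)" "g ` ?Z q \<subseteq> {x\<in>C. f p x = 0}" using inj[OF q] by blast
    then have "finite (?Z q)" using fin by (meson finite_imageD finite_subset)
    moreover have "card (?Z q) \<le> card {x\<in>C. f p x = 0}" by (rule card_inj_on_le[OF g fin])
    ultimately show "finite (?Z q) \<and> card (?Z q) \<le> card (?Z p)" using card by linarith
  qed
qed

section \<open>Angles whose cosine tends to zero\<close>

lemma tendsto_pi_half_if_cos_tendsto_0: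
  fixes g :: "real \<Rightarrow> real"
  assumes "\<forall>\<^sub>F x in F. 0 < g x \<and> g x < pi" "((\<lambda>x. cos (g x)) \<longlongrightarrow> 0) F"
  shows "(g \<longlongrightarrow> pi / 2) F"
proof -
  have "((\<lambda>x. arccos (cos (g x))) \<longlongrightarrow> arccos 0) F"
    by (rule isCont_tendsto_compose[OF _ assms(2)]) (simp add: isCont_arccos)
  moreover have "\<forall>\<^sub>F x in F. arccos (cos (g x)) = g x"
    using assms(1) by eventually_elim (simp add: arccos_cos)
  ultimately show ?thesis using Lim_transform_eventually by fastforce
qed

text \<open>
  Eventually \<open>g\<close> avoids all multiples of \<open>pi\<close>, so by continuity it is trapped between two consecutive ones.
\<close>

lemma tendsto_odd_pi_half_if_cos_tendsto_0:
  fixes g :: "real \<Rightarrow> real"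
  assumes cont: "continuous_on UNIV g" and lim: "((\<lambda>x. cos (g x)) \<longlongrightarrow> 0) at_top"
  shows "\<exists>l::int. (g \<longlongrightarrow> (2 * real_of_int l + 1) * (pi / 2)) at_top"
proof -
  have "\<forall>\<^sub>F x in at_top. \<bar>cos (g x)\<bar> < 1"
    using tendstoD[OF lim, of 1] by (simp add: dist_real_def)
  then obtain X where X: "\<And>x. x \<ge> X \<Longrightarrow> \<bar>cos (g x)\<bar> < 1"
    unfolding eventually_at_top_linorder by blast
  have no: "g x \<noteq> real_of_int j * pi" if "x \<ge> X" for x j
  proof
    assume g: "g x = real_of_int j * pi"
    have "\<bar>cos (g x)\<bar> = 1" unfolding g mult.commute[of _ pi] cos_npi_int by simp
    then show False using X[OF that] by simp
  qed
  define l where "l = \<lfloor>g X / pi\<rfloor>"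
  have l: "real_of_int l * pi \<le> g X" "g X < real_of_int (l + 1) * pi"
    using floor_divide_lower[OF pi_gt_zero, of "g X"] floor_divide_upper[OF pi_gt_zero, of "g X"] by (auto simp: l_def)
  have cx: "continuous_on {X..x} g" for x using cont continuous_on_subset by blast
  have lo: "real_of_int l * pi < g x" if "x \<ge> X" for x
  proof (rule ccontr)
    assume "\<not> ?thesis"
    then have "\<exists>y. X \<le> y \<and> y \<le> x \<and> g y = real_of_int l * pi"
      using l that cx by (intro IVT2') auto
    then show False using no by blast
  qed
  have hi: "g x < real_of_int (l + 1) * pi" if "x \<ge> X" for x
  proof (rule ccontr)
    assume "\<not> ?thesis"
    then have "\<exists>y. X \<le> y \<and> y \<le> x \<and> g y = real_of_int (l + 1) * pi"
      using l that cx by (intro IVT') auto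
    then show False using no by blast
  qed
  have "((\<lambda>x. g x - real_of_int l * pi) \<longlongrightarrow> pi / 2) at_top"
  proof (rule tendsto_pi_half_if_cos_tendsto_0)
    show "\<forall>\<^sub>F x in at_top. 0 < g x - real_of_int l * pi \<and> g x - real_of_int l * pi < pi"
      unfolding eventually_at_top_linorder using lo hi by (intro exI[of _ X]) (auto simp: algebra_simps)
    have "\<bar>cos (g x - real_of_int l * pi)\<bar> = \<bar>cos (g x)\<bar>" for x
      unfolding cos_diff mult.commute[of _ pi] cos_npi_int sin_npi_int by (simp add: abs_mult)
    then show "((\<lambda>x. cos (g x - real_of_int l * pi)) \<longlongrightarrow> 0) at_top"
      using tendsto_rabs_zero[OF lim] by (intro tendsto_rabs_zero_cancel[of "\<lambda>x. cos (g x - real_of_int l * pi)"]) simp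
  qed
  then have "((\<lambda>x. (g x - real_of_int l * pi) + real_of_int l * pi) \<longlongrightarrow> pi / 2 + real_of_int l * pi) at_top"
    by (intro tendsto_intros)
  then show ?thesis by (intro exI[of _ l]) (simp add: algebra_simps)
qed

lemma sin_lipschitz: "\<bar>sin x - sin y\<bar> \<le> \<bar>x - y\<bar>" for x y :: real
  using field_differentiable_bound[of UNIV sin cos 1 x y] by (auto intro: DERIV_sin)

section \<open>The singular initial value problem as a fixed-point equation\<close>

text \<open>
  The nonlinear part \<open>sin (2 y) / 2 - y\<close> of the pendulum torque, divided by \<open>y ^ 3\<close>. The quotient is
  needed because the integral equation is written for \<open>u = y / z\<close> and divides by \<open>z ^ 3\<close> at the
  singular end \<open>z = 0\<close>.
\<close>

definition cubic_sinc :: "real \<Rightarrow> real" where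
  "cubic_sinc x = (if x = 0 then - 2 / 3 else (sin (2 * x) / 2 - x) / x ^ 3)"

lemma continuous_on_cubic_sinc: "continuous_on UNIV cubic_sinc"
proof -
  have "isCont cubic_sinc x" for x
  proof (cases "x = 0")
    case True
    have "((\<lambda>x::real. (sin (2 * x) / 2 - x) / x ^ 3) \<longlongrightarrow> - 2 / 3) (at 0)" by real_asymp
    moreover have "\<forall>\<^sub>F x in at 0. (sin (2 * x) / 2 - x) / x ^ 3 = cubic_sinc x"
      by (auto simp: eventually_at_filter cubic_sinc_def)
    ultimately have "(cubic_sinc \<longlongrightarrow> - 2 / 3) (at 0)" using Lim_transform_eventually by blast
    then show ?thesis using True by (simp add: isCont_def cubic_sinc_def)
  next
    case False
    have "isCont (\<lambda>x::real. (sin (2 * x) / 2 - x) / x ^ 3) x"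
      using False by (intro continuous_intros) auto
    moreover have "\<forall>\<^sub>F y in nhds x. cubic_sinc y = (sin (2 * y) / 2 - y) / y ^ 3"
      using t1_space_nhds[OF False] by eventually_elim (simp add: cubic_sinc_def)
    ultimately show ?thesis by (simp add: isCont_cong)
  qed
  then show ?thesis by (simp add: continuous_at_imp_continuous_on)
qed

lemma cubic_sinc_mult: "z ^ 3 * (u ^ 3 * cubic_sinc (z * u)) = sin (2 * (z * u)) / 2 - z * u"
  by (cases "z * u = 0") (auto simp: cubic_sinc_def power_mult_distrib)

text \<open>
  The derivative with respect to \<open>u\<close> is \<open>- 2 (sin (z u))\<^sup>2 / z\<^sup>2\<close>, which is at most \<open>2 / z\<^sup>2\<close> for large \<open>z\<close>
  and at most \<open>2 u\<^sup>2\<close> for small \<open>z\<close>. The decay in \<open>z\<close> is what makes a polynomial weight sufficient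
  for the contraction.
\<close>

lemma cubic_sinc_lipschitz:
  assumes uv: "\<bar>z\<bar> \<le> 1 \<Longrightarrow> \<bar>u\<bar> \<le> 1" "\<bar>z\<bar> \<le> 1 \<Longrightarrow> \<bar>v\<bar> \<le> 1"
  shows "\<bar>u ^ 3 * cubic_sinc (z * u) - v ^ 3 * cubic_sinc (z * v)\<bar> \<le> 4 / (1 + z\<^sup>2) * \<bar>u - v\<bar>"
proof -
  define I where "I = (if \<bar>z\<bar> \<le> 1 then {-1..1} else UNIV :: real set)"
  define k' where "k' w = (if z = 0 then - 2 * w\<^sup>2 else - 2 * (sin (z * w))\<^sup>2 / z\<^sup>2)" for w
  have "convex I" "u \<in> I" "v \<in> I" using uv by (auto simp: I_def abs_le_iff)
  moreover have "((\<lambda>w. w ^ 3 * cubic_sinc (z * w)) has_field_derivative k' w) (at w within I)" for w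
  proof (cases "z = 0")
    case True
    then show ?thesis
      by (auto simp: k'_def cubic_sinc_def intro!: derivative_eq_intros)
  next
    case False
    have eq: "w ^ 3 * cubic_sinc (z * w) = (sin (2 * (z * w)) / 2 - z * w) / z ^ 3" for w
      using cubic_sinc_mult[of z w] False by (simp add: field_simps)
    have "((\<lambda>w. (sin (2 * (z * w)) / 2 - z * w) / z ^ 3) has_field_derivative k' w) (at w within I)"
    proof -
      have "((\<lambda>w. (sin (2 * (z * w)) / 2 - z * w) / z ^ 3) has_field_derivative
          (cos (2 * (z * w)) * (2 * z) / 2 - z) / z ^ 3) (at w within I)"
        by (intro DERIV_cdivide) (auto intro!: derivative_eq_intros)
      moreover have "(cos (2 * (z * w)) * (2 * z) / 2 - z) / z ^ 3 = k' w"
        unfolding k'_def cos_double_sin using False by (simp add: field_simps power2_eq_square power3_eq_cube)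
      ultimately show ?thesis by simp
    qed
    then show ?thesis by (simp add: eq)
  qed
  moreover have "norm (k' w) \<le> 4 / (1 + z\<^sup>2)" if w: "w \<in> I" for w
  proof (cases "\<bar>z\<bar> \<le> 1")
    case True
    then have z2: "z\<^sup>2 \<le> 1" by (simp add: abs_square_le_1)
    have w2: "w\<^sup>2 \<le> 1" using w True by (auto simp: I_def abs_square_le_1 abs_le_iff)
    have "(sin (z * w))\<^sup>2 \<le> (z * w)\<^sup>2" using abs_sin_x_le_abs_x[of "z * w"] by (simp add: abs_le_square_iff)
    then have "\<bar>k' w\<bar> \<le> 2 * w\<^sup>2"
      by (auto simp: k'_def field_simps power_mult_distrib)
    also have "\<dots> \<le> 2" using w2 by simp
    also have "\<dots> \<le> 4 / (1 + z\<^sup>2)" using z2 by (simp add: field_simps add_pos_nonneg)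
    finally show ?thesis by simp
  next
    case False
    then have z2: "z\<^sup>2 \<ge> 1" using abs_square_le_1[of z] by linarith
    have "\<bar>k' w\<bar> = 2 * (sin (z * w))\<^sup>2 / z\<^sup>2" using False by (auto simp: k'_def abs_mult)
    also have "\<dots> \<le> 2 * 1 / z\<^sup>2" by (intro divide_right_mono mult_left_mono) (auto simp: abs_square_le_1)
    also have "\<dots> = 4 / (2 * z\<^sup>2)" by simp
    also have "\<dots> \<le> 4 / (1 + z\<^sup>2)" using z2 by (intro divide_left_mono mult_pos_pos) auto
    finally show ?thesis by simp
  qed
  ultimately have "norm (u ^ 3 * cubic_sinc (z * u) - v ^ 3 * cubic_sinc (z * v)) \<le> 4 / (1 + z\<^sup>2) * norm (u - v)"
    by (intro field_differentiable_bound[where f="\<lambda>w. w ^ 3 * cubic_sinc (z * w)" and S=I and f'=k']) auto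
  then show ?thesis by simp
qed

text \<open>
  The friction near the two ends is \<open>m0 - 1\<close> and \<open>- (m1 - 1)\<close>, so the lower bounds make it positive at
  the first and negative at the second; the upper bound makes the first pendulum oscillate.
\<close>

locale join_bvp =
  fixes m0 m1 :: nat
  assumes m0_ge: "2 \<le> m0" and m0_le: "m0 \<le> 5" and m1_ge: "2 \<le> m1"
begin

text \<open>
  The constants of the contraction argument: \<open>L\<close> is the Lipschitz constant of \<open>force\<close> up to a factor
  \<open>1 / (1 + z\<^sup>2)\<close>, and at the same time the exponent of the weight \<open>\<Omega>\<close>, which makes the contraction factor \<open>1 / 2\<close>; \<open>\<epsilon>\<close> is so small
  that the solutions stay below \<open>1\<close> for \<open>\<bar>z\<bar> \<le> 1\<close>.
\<close>

definition n :: nat where "n = m0 + m1 - 2"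
definition L :: nat where "L = 4 * (m0 + n + 2) + 2"
definition \<epsilon> :: real where "\<epsilon> = 1 / 2 ^ (L + 1)"
definition \<Omega> :: "real \<Rightarrow> real" where "\<Omega> z = (1 + z\<^sup>2) ^ L"
text \<open>
  The parameter \<open>q\<close> enters through its square only. Capping the square at \<open>1\<close> makes all estimates
  uniform in \<open>q\<close>, so that the family can be constructed on the whole real line of parameters.
\<close>

definition lam :: "real \<Rightarrow> real" where "lam q = min 1 (q\<^sup>2)"
text \<open>
  With \<open>tan t = q z\<close> and \<open>\<bar>q\<bar> \<le> 1\<close>, this is \<open>(sin t)\<^sup>2\<close>. The next function, \<open>weight\<close>, is \<open>(cos t) ^ n\<close>.
\<close>

definition sin_sq :: "real \<Rightarrow> real \<Rightarrow> real" where "sin_sq q z = lam q * z\<^sup>2 / (1 + lam q * z\<^sup>2)"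
definition weight :: "real \<Rightarrow> real \<Rightarrow> real" where "weight q z = 1 / sqrt (1 + lam q * z\<^sup>2) ^ n"
text \<open>
  For \<open>r = z u\<close> the equation in self-adjoint form is
  \<open>(z ^ (m0 + 2) weight u')' = z ^ (m0 + 2) weight force\<close>. Integrating once gives \<open>slope\<close>, integrating
  again \<open>picard\<close>, with the initial value \<open>u 0 = \<epsilon>\<close>.
\<close>

definition force :: "real \<Rightarrow> real \<Rightarrow> real \<Rightarrow> real" where
  "force q z u = (m0 - (n + 2) * sin_sq q z) * (u ^ 3 * cubic_sinc (z * u)) - 2 * lam q / (1 + lam q * z\<^sup>2) * u"
definition slope :: "real \<Rightarrow> (real \<Rightarrow> real) \<Rightarrow> real \<Rightarrow> real" where
  "slope q u z = integral {0..1} (\<lambda>s. z * (s ^ (m0 + 2) * (weight q (z * s) / weight q z) * force q (z * s) (u (z * s))))"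
definition picard :: "real \<Rightarrow> (real \<Rightarrow> real) \<Rightarrow> real \<Rightarrow> real" where
  "picard q u z = \<epsilon> + integral {0..1} (\<lambda>s. z * slope q u (z * s))"

lemma lam_bounds: "0 \<le> lam q" "lam q \<le> 1" by (auto simp: lam_def)

lemma denom_pos: "1 + lam q * z\<^sup>2 > 0" using lam_bounds[of q] by (simp add: add_pos_nonneg)

lemma denom_neq_0 [simp]: "1 + lam q * z\<^sup>2 \<noteq> 0" using denom_pos[of q z] by linarith

lemma sin_sq_bounds: "0 \<le> sin_sq q z" "sin_sq q z < 1"
  using lam_bounds[of q] denom_pos[of q z] by (auto simp: sin_sq_def)

lemma weight_pos: "weight q z > 0" using denom_pos[of q z] by (simp add: weight_def)

lemma Omega_ge_1: "1 \<le> \<Omega> z" by (simp add: \<Omega>_def)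

lemma Omega_pos: "0 < \<Omega> z" using Omega_ge_1[of z] by linarith

lemma Omega_neq_0 [simp]: "\<Omega> z \<noteq> 0" using Omega_pos[of z] by simp

lemma continuous_on_Omega [continuous_intros]:
  "continuous_on A f \<Longrightarrow> continuous_on A (\<lambda>x. \<Omega> (f x))"
  unfolding \<Omega>_def by (intro continuous_intros)

lemma eps_pos: "\<epsilon> > 0" by (simp add: \<epsilon>_def)

lemma eps_le: "\<epsilon> \<le> 1"
  unfolding \<epsilon>_def using one_le_power[of "2::real" "L + 1"] by (simp del: power_Suc)

lemma eps_Omega_le: assumes "\<bar>z\<bar> \<le> 1" shows "2 * \<epsilon> * \<Omega> z \<le> 1"
proof -
  have "(1 + z\<^sup>2) ^ L \<le> 2 ^ L" using assms by (intro power_mono) (auto simp: abs_square_le_1)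
  then show ?thesis by (simp add: \<epsilon>_def \<Omega>_def field_simps)
qed

lemma continuous_on_lam [continuous_intros]:
  "continuous_on A f \<Longrightarrow> continuous_on A (\<lambda>x. lam (f x))"
  unfolding lam_def by (intro continuous_intros)

lemma continuous_on_weight [continuous_intros]:
  assumes "continuous_on A f" "continuous_on A g"
  shows "continuous_on A (\<lambda>x. weight (f x) (g x))"
  unfolding weight_def
proof (intro continuous_intros assms ballI)
  show "sqrt (1 + lam (f x) * (g x)\<^sup>2) ^ n \<noteq> 0" for x
    using denom_pos[of "f x" "g x"] by simp
qed

lemma continuous_on_sin_sq [continuous_intros]:
  assumes "continuous_on A f" "continuous_on A g"
  shows "continuous_on A (\<lambda>x. sin_sq (f x) (g x))"
  unfolding sin_sq_def by (intro continuous_intros assms ballI denom_neq_0)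

lemma continuous_on_force [continuous_intros]:
  assumes "continuous_on A f" "continuous_on A g" "continuous_on A h"
  shows "continuous_on A (\<lambda>x. force (f x) (g x) (h x))"
  unfolding force_def
  by (intro continuous_intros assms continuous_on_compose2[OF continuous_on_cubic_sinc]) auto

lemma continuous_on_slope:
  assumes U: "continuous_on UNIV (\<lambda>(q, z). U q z)"
  shows "continuous_on UNIV (\<lambda>(q, z). slope q (U q) z)"
proof -
  have "continuous_on (UNIV \<times> cbox 0 1) (\<lambda>(w, s). snd w * (s ^ (m0 + 2) * (weight (fst w) (snd w * s) / weight (fst w) (snd w)) * force (fst w) (snd w * s) (U (fst w) (snd w * s))))"
    unfolding split_def
    using weight_pos
    by (intro continuous_intros continuous_on_compose2[OF U, of _ "\<lambda>w. (fst (fst w), snd (fst w) * snd w)", simplified])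
      (auto simp: less_imp_neq[symmetric])
  then have "continuous_on UNIV (\<lambda>w. integral (cbox 0 1) (\<lambda>s. snd w * (s ^ (m0 + 2) * (weight (fst w) (snd w * s) / weight (fst w) (snd w)) * force (fst w) (snd w * s) (U (fst w) (snd w * s)))))"
    by (rule integral_continuous_on_param)
  then show ?thesis by (simp add: slope_def split_def)
qed

lemma continuous_on_picard:
  assumes U: "continuous_on UNIV (\<lambda>(q, z). U q z)"
  shows "continuous_on UNIV (\<lambda>(q, z). picard q (U q) z)"
proof -
  have "continuous_on (UNIV \<times> cbox 0 1) (\<lambda>(w, s). snd w * slope (fst w) (U (fst w)) (snd w * s))"
    unfolding split_def
    by (intro continuous_intros continuous_on_compose2[OF continuous_on_slope[OF U], of _ "\<lambda>w. (fst (fst w), snd (fst w) * snd w)", simplified])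
  then have "continuous_on UNIV (\<lambda>w. integral (cbox 0 1) (\<lambda>s. snd w * slope (fst w) (U (fst w)) (snd w * s)))"
    by (rule integral_continuous_on_param)
  then show ?thesis by (auto simp: picard_def split_def intro!: continuous_intros)
qed

lemma force_lipschitz:
  assumes "\<bar>z\<bar> \<le> 1 \<Longrightarrow> \<bar>u\<bar> \<le> 1" "\<bar>z\<bar> \<le> 1 \<Longrightarrow> \<bar>v\<bar> \<le> 1"
  shows "\<bar>force q z u - force q z v\<bar> \<le> L / (1 + z\<^sup>2) * \<bar>u - v\<bar>"
proof -
  let ?K = "\<lambda>u. u ^ 3 * cubic_sinc (z * u)"
  have a: "\<bar>m0 - real (n + 2) * sin_sq q z\<bar> \<le> real (m0 + n + 2)"
  proof -
    define c where "c = real (n + 2) * sin_sq q z"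
    have "0 \<le> c" "c \<le> real (n + 2) * 1"
      using sin_sq_bounds[of q z] unfolding c_def by (auto intro!: mult_left_mono mult_nonneg_nonneg)
    then show ?thesis unfolding c_def[symmetric] by (simp add: abs_le_iff)
  qed
  have "lam q * (1 + z\<^sup>2) \<le> 1 + lam q * z\<^sup>2" using lam_bounds[of q] by (simp add: algebra_simps)
  then have b: "2 * lam q / (1 + lam q * z\<^sup>2) \<le> 2 / (1 + z\<^sup>2)"
    using denom_pos[of q z] by (simp add: field_simps add_pos_nonneg)
  have b0: "0 \<le> 2 * lam q / (1 + lam q * z\<^sup>2)" using lam_bounds[of q] denom_pos[of q z] by simp
  have "force q z u - force q z v = (m0 - (n + 2) * sin_sq q z) * (?K u - ?K v) - 2 * lam q / (1 + lam q * z\<^sup>2) * (u - v)"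
    by (simp add: force_def algebra_simps diff_divide_distrib)
  also have "\<bar>\<dots>\<bar> \<le> \<bar>m0 - (n + 2) * sin_sq q z\<bar> * \<bar>?K u - ?K v\<bar> + \<bar>2 * lam q / (1 + lam q * z\<^sup>2)\<bar> * \<bar>u - v\<bar>"
    by (rule order_trans[OF abs_triangle_ineq4]) (simp only: abs_mult)
  also have "\<dots> \<le> real (m0 + n + 2) * (4 / (1 + z\<^sup>2) * \<bar>u - v\<bar>) + 2 / (1 + z\<^sup>2) * \<bar>u - v\<bar>"
    unfolding abs_of_nonneg[OF b0]
    by (intro add_mono mult_mono a b cubic_sinc_lipschitz assms mult_right_mono) auto
  also have "\<dots> = L / (1 + z\<^sup>2) * \<bar>u - v\<bar>"
    by (simp add: L_def add_divide_distrib algebra_simps)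
  finally show ?thesis .
qed

lemma force_0 [simp]: "force q z 0 = 0" by (simp add: force_def)

lemma slope_0 [simp]: "slope q (\<lambda>_. 0) z = 0" by (simp add: slope_def)

text \<open>
  The quotient \<open>(1 + l z\<^sup>2) / (1 + l (z s)\<^sup>2)\<close> increases with \<open>l\<close> and is at least \<open>1\<close>, so \<open>l\<close> may be replaced
  by \<open>1\<close> and the square root dropped.
\<close>

lemma weight_ratio_le:
  assumes s: "0 \<le> s" "s \<le> 1"
  shows "weight q (z * s) / weight q z \<le> ((1 + z\<^sup>2) / (1 + (z * s)\<^sup>2)) ^ n"
proof -
  let ?a = "1 + lam q * z\<^sup>2" and ?b = "1 + lam q * (z * s)\<^sup>2"
  have zs: "(z * s)\<^sup>2 \<le> z\<^sup>2" using s by (simp add: power_mult_distrib mult_left_le power_le_one)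
  have ab: "0 < ?b" "?b \<le> ?a" using denom_pos zs lam_bounds[of q] by (auto intro!: mult_left_mono)
  have "?a * (1 + (z * s)\<^sup>2) \<le> (1 + z\<^sup>2) * ?b"
  proof -
    have "(1 + z\<^sup>2) * ?b - ?a * (1 + (z * s)\<^sup>2) = (1 - lam q) * (z\<^sup>2 - (z * s)\<^sup>2)" by (simp add: algebra_simps)
    moreover have "0 \<le> (1 - lam q) * (z\<^sup>2 - (z * s)\<^sup>2)" using lam_bounds[of q] zs by (intro mult_nonneg_nonneg) auto
    ultimately show ?thesis by linarith
  qed
  then have r: "?a / ?b \<le> (1 + z\<^sup>2) / (1 + (z * s)\<^sup>2)"
    using ab by (simp add: field_simps add_pos_nonneg)
  have "weight q (z * s) / weight q z = sqrt (?a / ?b) ^ n"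
    by (simp add: weight_def real_sqrt_divide power_divide)
  also have "\<dots> \<le> (?a / ?b) ^ n"
  proof (intro power_mono)
    have "1 \<le> ?a / ?b" using ab by simp
    then have "sqrt (?a / ?b) \<le> sqrt ((?a / ?b)\<^sup>2)" unfolding power2_eq_square
      by (intro real_sqrt_le_mono) (simp only: mult_le_cancel_left1, auto)
    then show "sqrt (?a / ?b) \<le> ?a / ?b" using ab by (simp del: real_sqrt_le_iff)
  qed (use ab in auto)
  also have "\<dots> \<le> ((1 + z\<^sup>2) / (1 + (z * s)\<^sup>2)) ^ n"
    using r ab by (intro power_mono) auto
  finally show ?thesis .
qed

lemma continuous_slope_integrand:
  assumes "continuous_on UNIV u"
  shows "continuous_on A (\<lambda>s. z * (s ^ (m0 + 2) * (weight q (z * s) / weight q z) * force q (z * s) (u (z * s))))"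
  using weight_pos by (intro continuous_intros continuous_on_compose2[OF assms]) (auto simp: less_imp_neq[symmetric])

text \<open>
  The weight quotient costs \<open>(1 + z\<^sup>2) ^ n\<close> and gains \<open>(1 + (z s)\<^sup>2) ^ n\<close> in the denominator, which \<open>\<Omega>\<close> compensates
  because \<open>n + 1 \<le> L\<close>.
\<close>

lemma slope_contraction:
  assumes u: "continuous_on UNIV u" "\<And>y. \<bar>u y\<bar> \<le> 2 * \<epsilon> * \<Omega> y"
    and v: "continuous_on UNIV v" "\<And>y. \<bar>v y\<bar> \<le> 2 * \<epsilon> * \<Omega> y"
    and \<Delta>: "\<And>y. \<bar>u y - v y\<bar> \<le> \<Delta> * \<Omega> y"
  shows "\<bar>slope q u z - slope q v z\<bar> \<le> real L * \<Delta> * \<bar>z\<bar> * (1 + z\<^sup>2) ^ (L - 1)"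
proof -
  have \<Delta>0: "0 \<le> \<Delta>" using \<Delta>[of 0] by (simp add: \<Omega>_def)
  let ?integrand = "\<lambda>u s::real. z * (s ^ (m0 + 2) * (weight q (z * s) / weight q z) * force q (z * s) (u (z * s)))"
  let ?B = "real L * \<Delta> * \<bar>z\<bar> * (1 + z\<^sup>2) ^ (L - 1)"
  have int: "?integrand u integrable_on {0..1}" "?integrand v integrable_on {0..1}"
    by (intro integrable_continuous_interval continuous_slope_integrand u v)+
  have bd: "norm (?integrand u s - ?integrand v s) \<le> ?B" if s: "s \<in> {0..1}" for s
  proof -
    let ?y = "z * s"
    have small: "\<bar>u ?y\<bar> \<le> 1" "\<bar>v ?y\<bar> \<le> 1" if "\<bar>?y\<bar> \<le> 1"
      using u(2)[of ?y] v(2)[of ?y] eps_Omega_le[OF that] by linarith+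
    have fl: "\<bar>force q ?y (u ?y) - force q ?y (v ?y)\<bar> \<le> L / (1 + ?y\<^sup>2) * (\<Delta> * \<Omega> ?y)"
      by (rule order_trans[OF force_lipschitz[OF small] mult_left_mono[OF \<Delta>]]) auto
    have nL: "n + 1 \<le> L" by (simp add: L_def)
    have y1: "1 + ?y\<^sup>2 > 0" by (simp add: add_pos_nonneg)
    have zs: "?y\<^sup>2 \<le> z\<^sup>2" using s by (simp add: power_mult_distrib mult_left_le power_le_one)
    have "?integrand u s - ?integrand v s = z * (s ^ (m0 + 2) * (weight q ?y / weight q z) * (force q ?y (u ?y) - force q ?y (v ?y)))"
      by (simp add: algebra_simps)
    also have "norm \<dots> = \<bar>z\<bar> * (s ^ (m0 + 2) * (weight q ?y / weight q z) * \<bar>force q ?y (u ?y) - force q ?y (v ?y)\<bar>)"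
      using s weight_pos[of q ?y] weight_pos[of q z] by (simp add: abs_mult)
    also have "\<dots> \<le> \<bar>z\<bar> * (1 * ((1 + z\<^sup>2) / (1 + ?y\<^sup>2)) ^ n * (L / (1 + ?y\<^sup>2) * (\<Delta> * \<Omega> ?y)))"
      using s weight_pos[of q ?y] weight_pos[of q z]
      by (intro mult_left_mono mult_mono fl weight_ratio_le power_le_one) auto
    also have "\<dots> = L * \<Delta> * \<bar>z\<bar> * ((1 + z\<^sup>2) ^ n * (1 + ?y\<^sup>2) ^ (L - (n + 1)))"
    proof -
      have "\<Omega> ?y = (1 + ?y\<^sup>2) ^ n * (1 + ?y\<^sup>2) * (1 + ?y\<^sup>2) ^ (L - (n + 1))"
        using power_add[of "1 + ?y\<^sup>2" "n + 1" "L - (n + 1)"] nL by (simp add: \<Omega>_def mult.commute)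
      then show ?thesis using y1 by (simp add: power_divide)
    qed
    also have "\<dots> \<le> L * \<Delta> * \<bar>z\<bar> * ((1 + z\<^sup>2) ^ n * (1 + z\<^sup>2) ^ (L - (n + 1)))"
      using \<Delta>0 zs by (intro mult_left_mono power_mono) auto
    also have "\<dots> = ?B" using nL by (simp flip: power_add)
    finally show ?thesis .
  qed
  have "slope q u z - slope q v z = integral {0..1} (\<lambda>s. ?integrand u s - ?integrand v s)"
    unfolding slope_def using int by (simp add: Henstock_Kurzweil_Integration.integral_diff)
  also have "norm \<dots> \<le> ?B * (1 - 0)"
    using bd by (intro integral_bound continuous_on_diff continuous_slope_integrand u v) auto
  finally show ?thesis by simp
qed

lemma continuous_slope:
  assumes "continuous_on UNIV u" shows "continuous_on UNIV (slope q u)"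
proof -
  have "continuous_on UNIV ((\<lambda>(q, z). slope q u z) \<circ> (\<lambda>z. (q, z)))"
    by (intro continuous_on_compose continuous_intros continuous_on_subset[OF continuous_on_slope])
      (auto simp: split_def intro!: continuous_on_compose2[OF assms] continuous_intros)
  then show ?thesis by (simp add: o_def)
qed

text \<open>
  By \<open>slope_contraction\<close> the slopes differ by at most \<open>\<Delta> / 2\<close> times the absolute derivative of \<open>\<Omega>\<close>, whose
  factor \<open>L\<close> has absorbed the Lipschitz constant. It remains to integrate.
\<close>

lemma picard_contraction:
  assumes u: "continuous_on UNIV u" "\<And>y. \<bar>u y\<bar> \<le> 2 * \<epsilon> * \<Omega> y"
    and v: "continuous_on UNIV v" "\<And>y. \<bar>v y\<bar> \<le> 2 * \<epsilon> * \<Omega> y"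
    and \<Delta>: "\<And>y. \<bar>u y - v y\<bar> \<le> \<Delta> * \<Omega> y"
  shows "\<bar>picard q u z - picard q v z\<bar> \<le> \<Delta> / 2 * \<Omega> z"
proof -
  have \<Delta>0: "0 \<le> \<Delta>" using \<Delta>[of 0] by (simp add: \<Omega>_def)
  have cont: "continuous_on {0..1} (\<lambda>s. z * slope q u (z * s))" "continuous_on {0..1} (\<lambda>s. z * slope q v (z * s))"
    by (auto intro!: continuous_intros continuous_on_compose2[OF continuous_slope] u v)
  note int = cont[THEN integrable_continuous_interval]
  have L0: "L > 0" by (simp add: L_def)
  let ?G = "\<lambda>s. \<Delta> / 2 * (1 + (z * s)\<^sup>2) ^ L"
  let ?g = "\<lambda>s. real L * \<Delta> * z\<^sup>2 * s * (1 + (z * s)\<^sup>2) ^ (L - 1)"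
  have G: "(?g has_integral ?G 1 - ?G 0) {0..1}"
  proof (rule fundamental_theorem_of_calculus)
    fix s :: real
    have "(?G has_real_derivative ?g s) (at s)"
      using L0 by (auto intro!: derivative_eq_intros simp: power2_eq_square algebra_simps)
    then show "(?G has_vector_derivative ?g s) (at s within {0..1})"
      by (simp add: has_real_derivative_iff_has_vector_derivative has_vector_derivative_at_within)
  qed simp
  have bd: "norm (z * slope q u (z * s) - z * slope q v (z * s)) \<le> ?g s" if s: "s \<in> {0..1}" for s
  proof -
    have "norm (z * slope q u (z * s) - z * slope q v (z * s)) = \<bar>z\<bar> * \<bar>slope q u (z * s) - slope q v (z * s)\<bar>"
      by (simp add: abs_mult flip: right_diff_distrib)
    also have "\<dots> \<le> \<bar>z\<bar> * (L * \<Delta> * \<bar>z * s\<bar> * (1 + (z * s)\<^sup>2) ^ (L - 1))"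
      by (rule mult_left_mono[OF slope_contraction[OF u v \<Delta>]]) simp
    also have "\<dots> = ?g s" using s by (simp add: abs_mult power2_eq_square algebra_simps)
    finally show ?thesis .
  qed
  have "picard q u z - picard q v z = integral {0..1} (\<lambda>s. z * slope q u (z * s) - z * slope q v (z * s))"
    unfolding picard_def using int by (simp add: Henstock_Kurzweil_Integration.integral_diff del: integral_mult_right)
  also have "norm \<dots> \<le> integral {0..1} ?g"
    using bd G by (intro integral_norm_bound_integral integrable_diff int) (auto intro: has_integral_integrable)
  also have "\<dots> = ?G 1 - ?G 0" using G by (rule integral_unique)
  also have "\<dots> \<le> \<Delta> / 2 * \<Omega> z" using \<Delta>0 by (simp add: \<Omega>_def)
  finally show ?thesis by simp
qed

text \<open>
  The zero function is mapped to the constant \<open>\<epsilon>\<close>, so this is the contraction estimate against zero.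
\<close>

lemma picard_self_map:
  assumes u: "continuous_on UNIV u" "\<And>y. \<bar>u y\<bar> \<le> 2 * \<epsilon> * \<Omega> y"
  shows "\<bar>picard q u z - \<epsilon>\<bar> \<le> \<epsilon> * \<Omega> z"
proof -
  have "picard q (\<lambda>_. 0) z = \<epsilon>" by (simp add: picard_def)
  then show ?thesis
    using picard_contraction[OF u, of "\<lambda>_. 0" "2 * \<epsilon>" q z] u eps_pos Omega_pos by (auto simp: less_imp_le)
qed

lemma picard_fixed_unique:
  assumes u: "continuous_on UNIV u" "\<And>y. \<bar>u y\<bar> \<le> 2 * \<epsilon> * \<Omega> y" "\<And>y. picard q u y = u y"
    and v: "continuous_on UNIV v" "\<And>y. \<bar>v y\<bar> \<le> 2 * \<epsilon> * \<Omega> y" "\<And>y. picard q v y = v y"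
  shows "u z = v z"
proof -
  have "\<bar>u y - v y\<bar> \<le> 4 * \<epsilon> / 2 ^ k * \<Omega> y" for k y
  proof (induction k arbitrary: y)
    case 0
    then show ?case using u(2)[of y] v(2)[of y] by simp
  next
    case (Suc k)
    show ?case using picard_contraction[OF u(1,2) v(1,2) Suc, of q y] u(3) v(3) by (simp add: mult.commute)
  qed
  moreover have "(\<lambda>k. 4 * \<epsilon> / 2 ^ k * \<Omega> z) \<longlonglongrightarrow> 0" by real_asymp
  ultimately have "\<bar>u z - v z\<bar> \<le> 0" by (intro LIMSEQ_le_const) auto
  then show ?thesis by simp
qed

text \<open>
  Banach's theorem on the bounded continuous functions of the pair \<open>(q, z)\<close>. Treating the
  parameter as an argument of the unknown yields joint continuity of the solutions at once, without
  a separate theorem on dependence on parameters.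
\<close>

lemma picard_fixed_exists:
  "\<exists>U. continuous_on UNIV (\<lambda>(q, z). U q z) \<and> (\<forall>q z. \<bar>U q z - \<epsilon>\<bar> \<le> \<epsilon> * \<Omega> z)
    \<and> (\<forall>q z. picard q (U q) z = U q z)"
proof -
  define S where "S = (cball 0 \<epsilon> :: ((real \<times> real) \<Rightarrow>\<^sub>C real) set)"
  define U where "U \<phi> q z = \<epsilon> + \<Omega> z * apply_bcontfun \<phi> (q, z)" for \<phi> and q z :: real
  define T where "T \<phi> = Bcontfun (\<lambda>(q, z). (picard q (U \<phi> q) z - \<epsilon>) / \<Omega> z)" for \<phi>
  have Uc: "continuous_on UNIV (\<lambda>(q, z). U \<phi> q z)" for \<phi>
    unfolding U_def split_def \<Omega>_def
    by (intro continuous_intros continuous_on_compose2[OF continuous_on_apply_bcontfun[of UNIV \<phi>]]) auto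
  have Ucz: "continuous_on UNIV (U \<phi> q)" for \<phi> q
    unfolding U_def \<Omega>_def
    by (intro continuous_intros continuous_on_compose2[OF continuous_on_apply_bcontfun[of UNIV \<phi>]]) auto
  have Ub: "\<bar>U \<phi> q z\<bar> \<le> 2 * \<epsilon> * \<Omega> z" if \<phi>: "\<phi> \<in> S" for \<phi> q z
  proof -
    have "\<bar>apply_bcontfun \<phi> (q, z)\<bar> \<le> \<epsilon>" using norm_bounded[of \<phi> "(q, z)"] \<phi> by (simp add: S_def)
    then have "\<Omega> z * \<bar>apply_bcontfun \<phi> (q, z)\<bar> \<le> \<Omega> z * \<epsilon>" using Omega_pos[of z] by (intro mult_left_mono) auto
    moreover have "\<epsilon> \<le> \<epsilon> * \<Omega> z" using Omega_ge_1[of z] eps_pos by simp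
    moreover have "\<bar>U \<phi> q z\<bar> \<le> \<epsilon> + \<Omega> z * \<bar>apply_bcontfun \<phi> (q, z)\<bar>"
      unfolding U_def using eps_pos Omega_pos[of z] by (intro order_trans[OF abs_triangle_ineq]) (simp add: abs_mult)
    ultimately show ?thesis by (simp add: algebra_simps)
  qed
  have Tapp: "apply_bcontfun (T \<phi>) = (\<lambda>(q, z). (picard q (U \<phi> q) z - \<epsilon>) / \<Omega> z)" if \<phi>: "\<phi> \<in> S" for \<phi>
    unfolding T_def
  proof (rule Bcontfun_inverse, rule bcontfun_normI[where b=\<epsilon>])
    show "continuous_on UNIV (\<lambda>(q, z). (picard q (U \<phi> q) z - \<epsilon>) / \<Omega> z)"
      using continuous_on_picard[OF Uc[of \<phi>]] unfolding split_def
      by (intro continuous_intros) auto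
    show "norm (case x of (q, z) \<Rightarrow> (picard q (U \<phi> q) z - \<epsilon>) / \<Omega> z) \<le> \<epsilon>" for x
      using picard_self_map[OF Ucz Ub[OF \<phi>], of _ "fst x" "snd x"] Omega_pos[of "snd x"]
      by (simp add: split_def pos_divide_le_eq)
  qed
  have UT: "picard q (U \<phi> q) z = U (T \<phi>) q z" if "\<phi> \<in> S" for \<phi> q z
    using Omega_pos[of z] by (simp add: U_def Tapp[OF that])
  have "\<exists>!\<phi>. \<phi> \<in> S \<and> T \<phi> = \<phi>"
  proof (rule Banach_fix)
    show "complete S" unfolding S_def by (simp add: complete_eq_closed)
    show "S \<noteq> {}" unfolding S_def using eps_pos by (auto intro!: exI[of _ 0])
    show "0 \<le> (1/2::real)" "(1/2::real) < 1" by auto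
    show "T ` S \<subseteq> S"
    proof
      fix \<psi> assume "\<psi> \<in> T ` S"
      then obtain \<phi> where \<phi>: "\<phi> \<in> S" "\<psi> = T \<phi>" by blast
      have "norm (apply_bcontfun (T \<phi>) x) \<le> \<epsilon>" for x
        using picard_self_map[OF Ucz Ub[OF \<phi>(1)], of _ "fst x" "snd x"] Omega_pos[of "snd x"]
        by (simp add: Tapp[OF \<phi>(1)] split_def pos_divide_le_eq)
      then show "\<psi> \<in> S" unfolding S_def \<phi>(2) by (simp add: norm_bound)
    qed
    show "dist (T \<phi>) (T \<psi>) \<le> 1 / 2 * dist \<phi> \<psi>" if "\<phi> \<in> S" "\<psi> \<in> S" for \<phi> \<psi>
    proof (rule dist_bound)
      fix x :: "real \<times> real"
      obtain q z where x: "x = (q, z)" by force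
      have "\<bar>U \<phi> q y - U \<psi> q y\<bar> \<le> dist \<phi> \<psi> * \<Omega> y" for y
      proof -
        have "\<bar>U \<phi> q y - U \<psi> q y\<bar> = \<Omega> y * dist (apply_bcontfun \<phi> (q, y)) (apply_bcontfun \<psi> (q, y))"
          unfolding U_def dist_real_def using Omega_pos[of y] by (simp add: abs_mult flip: right_diff_distrib)
        also have "\<dots> \<le> \<Omega> y * dist \<phi> \<psi>"
          using Omega_pos[of y] by (intro mult_left_mono dist_bounded) auto
        finally show ?thesis by (simp add: mult.commute)
      qed
      then have "\<bar>picard q (U \<phi> q) z - picard q (U \<psi> q) z\<bar> \<le> dist \<phi> \<psi> / 2 * \<Omega> z"
        by (intro picard_contraction Ucz Ub that)
      then show "dist (apply_bcontfun (T \<phi>) x) (apply_bcontfun (T \<psi>) x) \<le> 1 / 2 * dist \<phi> \<psi>"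
        using Omega_pos[of z]
        by (simp add: x Tapp that dist_real_def flip: diff_divide_distrib) (simp add: pos_divide_le_eq)
    qed
  qed
  then obtain \<phi> where \<phi>: "\<phi> \<in> S" "T \<phi> = \<phi>" by blast
  show ?thesis
  proof (intro exI[of _ "U \<phi>"] conjI allI)
    show "continuous_on UNIV (\<lambda>(q, z). U \<phi> q z)" by (rule Uc)
    show "picard q (U \<phi> q) z = U \<phi> q z" for q z using UT[OF \<phi>(1)] \<phi>(2) by simp
    then show "\<bar>U \<phi> q z - \<epsilon>\<bar> \<le> \<epsilon> * \<Omega> z" for q z
      using picard_self_map[OF Ucz Ub[OF \<phi>(1)], of q q z] by simp
  qed
qed

section \<open>The family of solutions in logarithmic time\<close>

definition U :: "real \<Rightarrow> real \<Rightarrow> real" where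
  "U = (SOME U. continuous_on UNIV (\<lambda>(q, z). U q z) \<and> (\<forall>q z. \<bar>U q z - \<epsilon>\<bar> \<le> \<epsilon> * \<Omega> z)
    \<and> (\<forall>q z. picard q (U q) z = U q z))"

lemma
  shows continuous_on_U: "continuous_on UNIV (\<lambda>(q, z). U q z)"
    and U_dist_le: "\<bar>U q z - \<epsilon>\<bar> \<le> \<epsilon> * \<Omega> z"
    and picard_U: "picard q (U q) z = U q z"
  using someI_ex[OF picard_fixed_exists] unfolding U_def[symmetric] by auto

lemma continuous_on_U_comp [continuous_intros]:
  assumes "continuous_on A f" "continuous_on A g"
  shows "continuous_on A (\<lambda>x. U (f x) (g x))"
  using continuous_on_compose2[OF continuous_on_U, of A "\<lambda>x. (f x, g x)"] assms
  by (auto intro!: continuous_intros)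

lemma continuous_on_slope_U [continuous_intros]:
  assumes "continuous_on A f" "continuous_on A g"
  shows "continuous_on A (\<lambda>x. slope (f x) (U (f x)) (g x))"
  using continuous_on_compose2[OF continuous_on_slope[OF continuous_on_U], of A "\<lambda>x. (f x, g x)"] assms
  by (auto intro!: continuous_intros)

lemma U_le: "\<bar>U q z\<bar> \<le> 2 * \<epsilon> * \<Omega> z"
proof -
  have "\<bar>U q z\<bar> \<le> \<epsilon> + \<epsilon> * \<Omega> z" using U_dist_le[of q z] eps_pos by linarith
  moreover have "\<epsilon> \<le> \<epsilon> * \<Omega> z" using Omega_ge_1[of z] eps_pos by simp
  ultimately show ?thesis by linarith
qed

lemma U_0: "U q 0 = \<epsilon>" using picard_U[of q 0] by (simp add: picard_def)

lemma U_has_derivative: "(U q has_real_derivative slope q (U q) z) (at z)"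
proof -
  have "continuous_on UNIV (slope q (U q))"
    by (intro continuous_slope continuous_intros)
  then have "((\<lambda>z. integral {0..1} (\<lambda>s. z * slope q (U q) (z * s))) has_real_derivative slope q (U q) z) (at z)"
    by (rule scaled_integral_has_derivative)
  then have "((\<lambda>z. \<epsilon> + integral {0..1} (\<lambda>s. z * slope q (U q) (z * s))) has_real_derivative slope q (U q) z) (at z)"
    using DERIV_add[OF DERIV_const] by fastforce
  then show ?thesis unfolding picard_def[symmetric] picard_U .
qed

lemma weight_eq_exp: "weight q z = exp (- (real n * (ln (1 + lam q * z\<^sup>2) / 2)))"
proof -
  have "exp (real n * (ln (1 + lam q * z\<^sup>2) / 2)) = sqrt (1 + lam q * z\<^sup>2) ^ n"
    unfolding exp_of_nat_mult using denom_pos[of q z] by (simp flip: ln_sqrt)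
  then show ?thesis by (simp add: weight_def exp_minus inverse_eq_divide)
qed

lemma weight_has_derivative:
  "(weight q has_real_derivative - (real n * (lam q * z / (1 + lam q * z\<^sup>2))) * weight q z) (at z)"
  unfolding weight_eq_exp[abs_def] using denom_pos[of q z]
  by (auto intro!: derivative_eq_intros simp: field_simps)

text \<open>
  Clearing the denominators inside the definition of the slope shows it as a primitive with a
  variable upper limit.
\<close>

lemma slope_integral:
  "z ^ (m0 + 2) * weight q z * slope q u z
    = integral {0..1} (\<lambda>s. z * ((z * s) ^ (m0 + 2) * weight q (z * s) * force q (z * s) (u (z * s))))"
proof -
  have "z ^ (m0 + 2) * weight q z * slope q u z = integral {0..1} (\<lambda>s. (z ^ (m0 + 2) * weight q z) *
      (z * (s ^ (m0 + 2) * (weight q (z * s) / weight q z) * force q (z * s) (u (z * s)))))"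
    unfolding slope_def by (simp only: integral_mult_right)
  also have "\<dots> = integral {0..1} (\<lambda>s. z * ((z * s) ^ (m0 + 2) * weight q (z * s) * force q (z * s) (u (z * s))))"
    using weight_pos[of q z] by (intro Henstock_Kurzweil_Integration.integral_cong)
      (simp add: power_mult_distrib field_simps)
  finally show ?thesis .
qed

lemma slope_has_derivative:
  assumes z: "z > 0"
  shows "(slope q (U q) has_real_derivative
    force q z (U q z) - slope q (U q) z * ((real m0 + 2) / z - real n * (lam q * z / (1 + lam q * z\<^sup>2)))) (at z)"
proof -
  let ?h = "\<lambda>\<sigma>. \<sigma> ^ (m0 + 2) * weight q \<sigma> * force q \<sigma> (U q \<sigma>)"
  define I where "I z = integral {0..1} (\<lambda>s. z * ?h (z * s))" for z
  define W where "W z = z ^ (m0 + 2) * weight q z" for z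
  define W' where "W' = W z * ((real m0 + 2) / z - real n * (lam q * z / (1 + lam q * z\<^sup>2)))"
  have "continuous_on UNIV ?h" by (intro continuous_intros)
  then have I: "(I has_real_derivative ?h z) (at z)"
    unfolding I_def by (rule scaled_integral_has_derivative)
  have W0: "W y \<noteq> 0" if "y > 0" for y using weight_pos[of q y] that by (simp add: W_def)
  have W: "(W has_real_derivative W') (at z)"
  proof -
    define r where "r = real n * (lam q * z / (1 + lam q * z\<^sup>2))"
    have "(W has_real_derivative real (m0 + 2) * z ^ (m0 + 1) * weight q z + - r * weight q z * z ^ (m0 + 2)) (at z)"
      unfolding W_def r_def
      using DERIV_mult[OF DERIV_pow[of "m0 + 2" z] weight_has_derivative[of q z]] by (simp add: algebra_simps)
    moreover have "real (m0 + 2) * z ^ (m0 + 1) * weight q z + - r * weight q z * z ^ (m0 + 2) = W'"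
      unfolding W'_def W_def r_def[symmetric] using z by (simp add: field_simps)
    ultimately show ?thesis by simp
  qed
  have eq: "I y / W y = slope q (U q) y" if "y > 0" for y
    using slope_integral[of y q "U q"] W0[OF that] by (simp add: I_def W_def field_simps)
  have "((\<lambda>y. I y / W y) has_real_derivative (?h z * W z - I z * W') / (W z * W z)) (at z)"
    by (rule DERIV_divide[OF I W W0[OF z]])
  also have "(?h z * W z - I z * W') / (W z * W z) = force q z (U q z) - I z / W z * (W' / W z)"
    using W0[OF z] by (simp add: W_def field_simps)
  also have "W' / W z = (real m0 + 2) / z - real n * (lam q * z / (1 + lam q * z\<^sup>2))"
    using W0[OF z] by (simp add: W'_def)
  also have "I z / W z = slope q (U q) z" by (rule eq[OF z])
  finally show ?thesis
    using z eq by (elim has_field_derivative_transform_within_open[where S="{0<..}"]) auto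
qed

definition S :: "real \<Rightarrow> real \<Rightarrow> real" where "S q x = sin_sq q (exp x)"
text \<open>
  The solutions as functions of \<open>x = ln z\<close>, where \<open>z = tan t / q\<close>. In this variable the equation has
  no singularity, and for \<open>q = 0\<close> it is autonomous.
\<close>

definition f :: "real \<Rightarrow> real \<Rightarrow> real" where "f q x = exp x * U q (exp x)"
definition f' :: "real \<Rightarrow> real \<Rightarrow> real" where
  "f' q x = exp x * U q (exp x) + (exp x)\<^sup>2 * slope q (U q) (exp x)"
definition f'' :: "real \<Rightarrow> real \<Rightarrow> real" where
  "f'' q x = - (real m0 - 1 - real n * S q x) * f' q x + (real m0 - real (n + 2) * S q x) / 2 * sin (2 * f q x)"

lemma f_has_derivative: "(f q has_real_derivative f' q x) (at x)"
  unfolding f_def f'_def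
  by (auto intro!: derivative_eq_intros DERIV_chain2[OF U_has_derivative] simp: power2_eq_square algebra_simps)

lemma f'_has_derivative: "(f' q has_real_derivative f'' q x) (at x)"
proof -
  define z where "z = exp x"
  define D where "D = slope q (U q) z"
  define u where "u = U q z"
  define s where "s = sin_sq q z"
  define D' where "D' = force q z u - D * ((real m0 + 2) / z - real n * (lam q * z / (1 + lam q * z\<^sup>2)))"
  have z: "z > 0" by (simp add: z_def)
  have D: "((\<lambda>x. slope q (U q) (exp x)) has_real_derivative D' * z) (at x)"
    using DERIV_chain2[OF slope_has_derivative[of z q, unfolded z_def] DERIV_exp[of x]]
    by (simp add: D'_def D_def u_def z_def)
  have "((\<lambda>x. exp x * U q (exp x) + (exp x)\<^sup>2 * slope q (U q) (exp x)) has_real_derivative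
      (z * u + z * (D * z)) + (2 * z * z * D + z\<^sup>2 * (D' * z))) (at x)"
    by (auto intro!: derivative_eq_intros D DERIV_chain2[OF U_has_derivative]
        simp: z_def u_def D_def algebra_simps)
  moreover have "(z * u + z * (D * z)) + (2 * z * z * D + z\<^sup>2 * (D' * z)) = f'' q x"
  proof -
    have s: "lam q * z / (1 + lam q * z\<^sup>2) = s / z" "2 * lam q / (1 + lam q * z\<^sup>2) = 2 * s / z\<^sup>2"
      using z by (auto simp: s_def sin_sq_def power2_eq_square)
    have "z ^ 3 * force q z u = (m0 - (n + 2) * s) * (z ^ 3 * (u ^ 3 * cubic_sinc (z * u))) - 2 * s * (z * u)"
      unfolding force_def s s_def[symmetric] using z by (simp add: field_simps power2_eq_square power3_eq_cube)
    also have "\<dots> = (m0 - (n + 2) * s) * (sin (2 * (z * u)) / 2 - z * u) - 2 * s * (z * u)"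
      unfolding cubic_sinc_mult ..
    finally have force_eq: "z ^ 3 * force q z u = (m0 - (n + 2) * s) * (sin (2 * (z * u)) / 2 - z * u) - 2 * s * (z * u)" .
    have "z\<^sup>2 * (D' * z) = z ^ 3 * force q z u - z\<^sup>2 * D * (real m0 + 2 - real n * s)"
      unfolding D'_def s using z by (simp add: field_simps power2_eq_square power3_eq_cube)
    also note force_eq
    finally have G: "z\<^sup>2 * (D' * z) = (m0 - (n + 2) * s) * (sin (2 * (z * u)) / 2 - z * u) - 2 * s * (z * u)
      - z\<^sup>2 * D * (real m0 + 2 - real n * s)" .
    show ?thesis
      unfolding G f''_def f'_def f_def S_def z_def[symmetric] u_def[symmetric] D_def[symmetric] s_def[symmetric]
      by (simp add: field_simps power2_eq_square)
  qed
  ultimately show ?thesis by (simp add: f'_def[abs_def])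
qed

lemma continuous_on_f: "continuous_on A (\<lambda>(q, x). f q x)"
  unfolding f_def split_def by (intro continuous_intros)

lemma continuous_on_f': "continuous_on A (\<lambda>(q, x). f' q x)"
  unfolding f'_def split_def by (intro continuous_intros)

lemma S_bounds: "0 \<le> S q x" "S q x < 1" using sin_sq_bounds by (auto simp: S_def)

lemma f_over_exp_tendsto: "((\<lambda>x. f q x / exp x) \<longlongrightarrow> \<epsilon>) at_bot"
proof -
  have "isCont (U q) 0" using U_has_derivative DERIV_isCont by blast
  then have "((\<lambda>x. U q (exp x)) \<longlongrightarrow> U q 0) at_bot"
    using isCont_tendsto_compose exp_at_bot by blast
  then show ?thesis by (simp add: f_def U_0)
qed

lemma f_tendsto_0: "((\<lambda>x. f q x) \<longlongrightarrow> 0) at_bot"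
proof -
  have "((\<lambda>x. f q x / exp x * exp x) \<longlongrightarrow> \<epsilon> * 0) at_bot"
    by (intro tendsto_intros f_over_exp_tendsto exp_at_bot)
  then show ?thesis by simp
qed

lemma f'_tendsto_0: "((\<lambda>x. f' q x) \<longlongrightarrow> 0) at_bot"
proof -
  have "isCont (slope q (U q)) 0"
    using continuous_slope[of "U q" q] U_has_derivative
    by (metis DERIV_isCont continuous_at_imp_continuous_on continuous_on_eq_continuous_at open_UNIV UNIV_I)
  then have "((\<lambda>x. slope q (U q) (exp x)) \<longlongrightarrow> slope q (U q) 0) at_bot"
    using isCont_tendsto_compose exp_at_bot by blast
  then have "((\<lambda>x. f q x + (exp x)\<^sup>2 * slope q (U q) (exp x)) \<longlongrightarrow> 0 + 0\<^sup>2 * slope q (U q) 0) at_bot"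
    by (intro tendsto_intros f_tendsto_0 exp_at_bot)
  then show ?thesis by (simp add: f_def f'_def)
qed

lemma f_pos_near_bot: "\<forall>\<^sub>F x in at_bot. f q x > 0"
  using order_tendstoD(1)[OF f_over_exp_tendsto eps_pos] by (rule eventually_mono) (simp add: zero_less_divide_iff)

lemma f_le_1: assumes "x \<le> 0" shows "\<bar>f q x\<bar> \<le> 1"
proof -
  have "\<bar>U q (exp x)\<bar> \<le> 1" using U_le[of q "exp x"] eps_Omega_le[of "exp x"] assms by simp
  then show ?thesis using assms by (simp add: f_def abs_mult mult_le_one)
qed

lemma lam_eps: "lam \<epsilon> = \<epsilon>\<^sup>2"
  using eps_pos eps_le by (simp add: lam_def abs_square_le_1)

text \<open>
  For \<open>q = \<epsilon>\<close> the family contains the identity solution \<open>r t = t\<close>, because \<open>arctan (\<epsilon> z) / z\<close> is a fixed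
  point of the same contraction. It is verified by integrating the self-adjoint form of the equation twice.
\<close>

lemma f_eps: "f \<epsilon> x = arctan (\<epsilon> * exp x)"
proof -
  define v where "v z = (if z = 0 then \<epsilon> else arctan (\<epsilon> * z) / z)" for z
  define p where "p z = 1 + \<epsilon>\<^sup>2 * z\<^sup>2" for z
  have p: "p z > 0" for z by (simp add: p_def add_pos_nonneg)
  have p0: "p z \<noteq> 0" for z using p[of z] by simp
  define k where "k z = \<epsilon> * z / p z - arctan (\<epsilon> * z)" for z
  have k: "(k has_real_derivative - 2 * \<epsilon> ^ 3 * z\<^sup>2 / (p z)\<^sup>2) (at z)" for z
  proof -
    have dp: "(p has_real_derivative 2 * \<epsilon>\<^sup>2 * z) (at z)"
      unfolding p_def by (auto intro!: derivative_eq_intros)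
    have pz: "1 + (\<epsilon> * z)\<^sup>2 = p z" by (simp add: p_def power_mult_distrib)
    have "(k has_real_derivative (\<epsilon> * p z - \<epsilon> * z * (2 * \<epsilon>\<^sup>2 * z)) / (p z * p z) - inverse (1 + (\<epsilon> * z)\<^sup>2) * \<epsilon>) (at z)"
      unfolding k_def by (auto intro!: derivative_eq_intros dp p0)
    moreover have "(\<epsilon> * p z - \<epsilon> * z * (2 * \<epsilon>\<^sup>2 * z)) / (p z * p z) - inverse (1 + (\<epsilon> * z)\<^sup>2) * \<epsilon>
        = - 2 * \<epsilon> ^ 3 * z\<^sup>2 / (p z)\<^sup>2"
      unfolding pz using p0[of z] by (simp add: field_simps power2_eq_square power3_eq_cube)
    ultimately show ?thesis by (simp only:)
  qed
  have v_le: "\<bar>v z\<bar> \<le> \<epsilon>" for z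
  proof -
    have "\<bar>arctan (\<epsilon> * z)\<bar> \<le> \<bar>\<epsilon> * z\<bar>" by (rule abs_arctan_le)
    then show ?thesis using eps_pos by (simp add: v_def abs_mult pos_divide_le_eq)
  qed
  have v_bound: "\<bar>v z\<bar> \<le> 2 * \<epsilon> * \<Omega> z" for z
  proof -
    have "\<epsilon> * 1 \<le> \<epsilon> * \<Omega> z" using eps_pos Omega_ge_1 by (intro mult_left_mono) auto
    then show ?thesis using v_le[of z] eps_pos by linarith
  qed
  have dv: "(v has_real_derivative k z / z\<^sup>2) (at z)" if z: "z \<noteq> 0" for z
  proof -
    have pz: "1 + (\<epsilon> * z)\<^sup>2 = p z" by (simp add: p_def power_mult_distrib)
    have "((\<lambda>z. arctan (\<epsilon> * z) / z) has_real_derivative (inverse (1 + (\<epsilon> * z)\<^sup>2) * \<epsilon> * z - arctan (\<epsilon> * z) * 1) / (z * z)) (at z)"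
      using z by (auto intro!: derivative_eq_intros)
    then have "((\<lambda>z. arctan (\<epsilon> * z) / z) has_real_derivative k z / z\<^sup>2) (at z)"
      unfolding pz k_def by (simp add: power2_eq_square field_simps)
    then show ?thesis
      using z by (elim has_field_derivative_transform_within_open[where S="-{0}"]) (auto simp: v_def)
  qed
  have contv: "continuous_on UNIV v"
  proof (rule continuous_at_imp_continuous_on, rule ballI)
    fix z show "isCont v z"
    proof (cases "z = 0")
      case True
      have "((\<lambda>z. arctan (\<epsilon> * z)) has_real_derivative \<epsilon>) (at 0)"
        by (auto intro!: derivative_eq_intros)
      then have "((\<lambda>z. arctan (\<epsilon> * z) / z) \<longlongrightarrow> \<epsilon>) (at 0)" by (simp add: has_field_derivative_iff)
      moreover have "\<forall>\<^sub>F z in at 0. arctan (\<epsilon> * z) / z = v z"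
        by (auto simp: eventually_at_filter v_def)
      ultimately have "(v \<longlongrightarrow> \<epsilon>) (at 0)" using Lim_transform_eventually by blast
      then show ?thesis using True by (simp add: isCont_def v_def)
    next
      case False
      then show ?thesis using dv DERIV_isCont by blast
    qed
  qed
  have zv: "z * v z = arctan (\<epsilon> * z)" for z by (simp add: v_def)
  let ?h = "\<lambda>z. z ^ (m0 + 2) * weight \<epsilon> z * force \<epsilon> z (v z)"
  \<comment> \<open>\<open>z ^ (m0 + 2) * weight \<epsilon> z\<close> times the derivative \<open>k z / z\<^sup>2\<close> of \<open>v\<close>, written so that it is continuous at \<open>0\<close>\<close>
  define Y where "Y z = z ^ m0 * weight \<epsilon> z * k z" for z
  have contY: "continuous_on UNIV Y"
    unfolding Y_def by (intro continuous_intros) (meson DERIV_isCont continuous_at_imp_continuous_on k)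
  have dY: "(Y has_real_derivative ?h z) (at z)" if z: "z \<noteq> 0" for z
  proof -
    define \<theta> where "\<theta> = arctan (\<epsilon> * z)"
    define P where "P = p z"
    define c where "c = \<epsilon> * z"
    have P: "P > 0" "P \<noteq> 0" using p[of z] by (auto simp: P_def)
    have Pc: "P = 1 + c\<^sup>2" by (simp add: P_def p_def c_def power_mult_distrib)
    have kz: "k z = c / P - \<theta>" by (simp add: k_def c_def P_def \<theta>_def)
    have sin: "sin (2 * \<theta>) / 2 = c / P"
    proof -
      have "sin \<theta> * cos \<theta> = c / (sqrt (1 + c\<^sup>2) * sqrt (1 + c\<^sup>2))"
        unfolding \<theta>_def c_def sin_arctan cos_arctan by simp
      also have "\<dots> = c / P" unfolding Pc real_sqrt_mult_self by (simp add: add_nonneg_nonneg)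
      finally show ?thesis unfolding sin_double by simp
    qed
    have "z ^ 3 * force \<epsilon> z (v z) = (m0 - (n + 2) * (c\<^sup>2 / P)) * (c / P - \<theta>) - 2 * (c\<^sup>2 / P) * \<theta>"
    proof -
      have sin_sq: "sin_sq \<epsilon> z = c\<^sup>2 / P" and l: "2 * lam \<epsilon> / (1 + lam \<epsilon> * z\<^sup>2) * z ^ 3 = 2 * (c\<^sup>2 / P) * z"
        using z by (simp_all add: sin_sq_def lam_eps P_def p_def c_def power_mult_distrib power2_eq_square power3_eq_cube)
      have "z ^ 3 * force \<epsilon> z (v z) = (m0 - (n + 2) * sin_sq \<epsilon> z) * (z ^ 3 * (v z ^ 3 * cubic_sinc (z * v z)))
          - (2 * lam \<epsilon> / (1 + lam \<epsilon> * z\<^sup>2) * z ^ 3) * v z"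
        unfolding force_def by (simp only: algebra_simps)
      also have "\<dots> = (m0 - (n + 2) * (c\<^sup>2 / P)) * (c / P - \<theta>) - 2 * (c\<^sup>2 / P) * \<theta>"
      proof -
        have cs: "z ^ 3 * (v z ^ 3 * cubic_sinc (z * v z)) = c / P - \<theta>"
          using cubic_sinc_mult[of z "v z"] unfolding zv \<theta>_def[symmetric] sin .
        have "2 * (c\<^sup>2 / P) * z * v z = 2 * (c\<^sup>2 / P) * \<theta>"
          by (simp only: mult.assoc zv \<theta>_def)
        then show ?thesis unfolding cs l sin_sq by (simp only:)
      qed
      finally show ?thesis .
    qed
    then have force_eq: "z ^ 3 * force \<epsilon> z (v z) = (m0 - (n + 2) * (c\<^sup>2 / P)) * (c / P - \<theta>) - 2 * (c\<^sup>2 / P) * \<theta>" .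
    have "z ^ (m0 + 2) = z ^ (m0 - 1) * z ^ 3" using m0_ge by (simp flip: power_add)
    then have "?h z = z ^ (m0 - 1) * weight \<epsilon> z * (z ^ 3 * force \<epsilon> z (v z))" by (simp only: mult_ac)
    then have h: "?h z = z ^ (m0 - 1) * weight \<epsilon> z * ((m0 - (n + 2) * (c\<^sup>2 / P)) * (c / P - \<theta>) - 2 * (c\<^sup>2 / P) * \<theta>)"
      unfolding force_eq .
    have "(Y has_real_derivative (real m0 * z ^ (m0 - 1) * weight \<epsilon> z + z ^ m0 * (- (real n * (lam \<epsilon> * z / (1 + lam \<epsilon> * z\<^sup>2))) * weight \<epsilon> z)) * k z
        + z ^ m0 * weight \<epsilon> z * (- 2 * \<epsilon> ^ 3 * z\<^sup>2 / (p z)\<^sup>2)) (at z)"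
      unfolding Y_def by (auto intro!: derivative_eq_intros weight_has_derivative k simp: algebra_simps)
    moreover have "(real m0 * z ^ (m0 - 1) * weight \<epsilon> z + z ^ m0 * (- (real n * (lam \<epsilon> * z / (1 + lam \<epsilon> * z\<^sup>2))) * weight \<epsilon> z)) * k z
        + z ^ m0 * weight \<epsilon> z * (- 2 * \<epsilon> ^ 3 * z\<^sup>2 / (p z)\<^sup>2) = ?h z"
    proof -
      have zm: "z ^ m0 = z ^ (m0 - 1) * z" using m0_ge by (simp flip: power_Suc2)
      have 1: "lam \<epsilon> * z / (1 + lam \<epsilon> * z\<^sup>2) * z = c\<^sup>2 / P"
        by (simp add: lam_eps P_def p_def c_def power_mult_distrib power2_eq_square)
      have 2: "z * (- 2 * \<epsilon> ^ 3 * z\<^sup>2 / (p z)\<^sup>2) = - 2 * c ^ 3 / P\<^sup>2"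
        by (simp add: P_def c_def power_mult_distrib power2_eq_square power3_eq_cube)
      have alg: "(a * y * w + (y * z) * (- (b * r) * w)) * kk + (y * z) * w * e = y * w * ((a - b * (r * z)) * kk + z * e)"
        for a y w b r kk e :: real by (simp add: algebra_simps)
      have "(real m0 * z ^ (m0 - 1) * weight \<epsilon> z + z ^ m0 * (- (real n * (lam \<epsilon> * z / (1 + lam \<epsilon> * z\<^sup>2))) * weight \<epsilon> z)) * k z
        + z ^ m0 * weight \<epsilon> z * (- 2 * \<epsilon> ^ 3 * z\<^sup>2 / (p z)\<^sup>2)
        = z ^ (m0 - 1) * weight \<epsilon> z * ((m0 - n * (lam \<epsilon> * z / (1 + lam \<epsilon> * z\<^sup>2) * z)) * k z + z * (- 2 * \<epsilon> ^ 3 * z\<^sup>2 / (p z)\<^sup>2))"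
        unfolding zm by (rule alg)
      also have "\<dots> = z ^ (m0 - 1) * weight \<epsilon> z * ((m0 - n * (c\<^sup>2 / P)) * k z + (- 2 * c ^ 3 / P\<^sup>2))"
        unfolding 1 2 ..
      also have "(m0 - n * (c\<^sup>2 / P)) * k z + (- 2 * c ^ 3 / P\<^sup>2)
          = (m0 - (n + 2) * (c\<^sup>2 / P)) * (c / P - \<theta>) - 2 * (c\<^sup>2 / P) * \<theta>"
        unfolding kz using P by (simp add: field_simps power2_eq_square power3_eq_cube)
      finally show ?thesis unfolding h .
    qed
    ultimately show ?thesis by simp
  qed
  have slope_v: "slope \<epsilon> v z = k z / z\<^sup>2" if z: "z \<noteq> 0" for z
  proof -
    have "continuous_on UNIV ?h" by (intro continuous_intros contv)
    then have "Y z = Y 0 + integral {0..1} (\<lambda>s. z * ?h (z * s))"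
      by (rule scaled_integral_unique[OF _ contY dY])
    also have "\<dots> = z ^ (m0 + 2) * weight \<epsilon> z * slope \<epsilon> v z"
      unfolding slope_integral using m0_ge by (simp add: Y_def)
    finally show ?thesis using z weight_pos[of \<epsilon> z] by (simp add: Y_def field_simps power2_eq_square)
  qed
  have pv: "picard \<epsilon> v z = v z" for z
  proof -
    have "v z = v 0 + integral {0..1} (\<lambda>s. z * slope \<epsilon> v (z * s))"
      by (rule scaled_integral_unique[OF continuous_slope[OF contv] contv]) (simp add: slope_v dv)
    then show ?thesis by (simp add: picard_def v_def)
  qed
  have contU: "continuous_on UNIV (U \<epsilon>)" by (intro continuous_intros)
  have "U \<epsilon> (exp x) = v (exp x)"
    by (rule picard_fixed_unique[OF contU U_le picard_U contv v_bound pv])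
  then show ?thesis by (simp add: f_def v_def)
qed

text \<open>
  The angles \<open>c\<close> are the rest points of the pendulum; by uniqueness a solution at rest is constant,
  but these solutions tend to \<open>0\<close> without being \<open>0\<close>.
\<close>

lemma f_not_at_rest:
  assumes c: "sin (2 * c) = 0" and x: "f q x = c" "f' q x = 0"
  shows False
proof -
  have "f q y - c = 0" for y
  proof (rule second_order_zero_data_imp_zero[where y="\<lambda>x. f q x - c" and y'="f' q" and y''="f'' q" and z=x
        and K="real (m0 + n + 2)"])
    fix x
    show "((\<lambda>x. f q x - c) has_real_derivative f' q x) (at x)"
      by (auto intro!: derivative_eq_intros f_has_derivative)
    show "(f' q has_real_derivative f'' q x) (at x)" by (rule f'_has_derivative)
    define w v where "w = real n * S q x" and "v = real (n + 2) * S q x"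
    have "0 \<le> w" "w \<le> real n" "0 \<le> v" "v \<le> real (n + 2)"
      unfolding w_def v_def using S_bounds[of q x] by (auto intro!: mult_nonneg_nonneg mult_left_le)
    then have 1: "\<bar>real m0 - 1 - w\<bar> \<le> real (m0 + n + 2)"
      and 2: "\<bar>(real m0 - v) / 2\<bar> \<le> real (m0 + n + 2) / 2"
      using m0_ge by (simp_all add: abs_le_iff)
    have 3: "\<bar>sin (2 * f q x)\<bar> \<le> 2 * \<bar>f q x - c\<bar>"
    proof -
      have "\<bar>2 * f q x - 2 * c\<bar> = 2 * \<bar>f q x - c\<bar>"
        by (simp only: right_diff_distrib[symmetric] abs_mult abs_numeral)
      then show ?thesis using sin_lipschitz[of "2 * f q x" "2 * c"] unfolding c by simp
    qed
    have "\<bar>f'' q x\<bar> \<le> \<bar>real m0 - 1 - w\<bar> * \<bar>f' q x\<bar> + \<bar>(real m0 - v) / 2\<bar> * \<bar>sin (2 * f q x)\<bar>"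
      unfolding f''_def w_def v_def by (rule order_trans[OF abs_triangle_ineq]) (simp only: abs_mult abs_minus_cancel order_refl)
    also have "\<dots> \<le> real (m0 + n + 2) * \<bar>f' q x\<bar> + real (m0 + n + 2) / 2 * (2 * \<bar>f q x - c\<bar>)"
      using 1 2 3 by (intro add_mono mult_mono) auto
    also have "\<dots> = real (m0 + n + 2) * (\<bar>f q x - c\<bar> + \<bar>f' q x\<bar>)" by (simp add: algebra_simps)
    finally show "\<bar>f'' q x\<bar> \<le> real (m0 + n + 2) * (\<bar>f q x - c\<bar> + \<bar>f' q x\<bar>)" .
  qed (use x in auto)
  then have fc: "f q = (\<lambda>_. c)" by auto
  have "c = 0" using f_tendsto_0[of q] unfolding fc by (simp add: tendsto_const_iff)
  then have "\<forall>\<^sub>F x::real in at_bot. False" using f_pos_near_bot[of q] unfolding fc by simp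
  then show False by simp
qed

lemma node_simple: "f q x = pi / 2 \<Longrightarrow> f' q x \<noteq> 0"
  using f_not_at_rest[of "pi / 2"] by auto

lemma continuous_on_f_q: "continuous_on A (f q)"
  using f_has_derivative by (meson DERIV_isCont continuous_at_imp_continuous_on)

lemma continuous_on_f'_q: "continuous_on A (f' q)"
  using f'_has_derivative by (meson DERIV_isCont continuous_at_imp_continuous_on)

section \<open>Infinite initial slope\<close>

text \<open>
  The energy of the autonomous damped pendulum reached for \<open>q = 0\<close>.
\<close>

definition energy :: "real \<Rightarrow> real" where "energy x = (f' 0 x)\<^sup>2 / 2 - real m0 / 2 * (sin (f 0 x))\<^sup>2"

lemma f''_0: "f'' 0 x = - (real m0 - 1) * f' 0 x + real m0 / 2 * sin (2 * f 0 x)"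
  by (simp add: f''_def S_def sin_sq_def lam_def)

lemma energy_has_derivative: "(energy has_real_derivative - (real m0 - 1) * (f' 0 x)\<^sup>2) (at x)"
proof -
  have "(energy has_real_derivative f' 0 x * f'' 0 x - real m0 * sin (f 0 x) * cos (f 0 x) * f' 0 x) (at x)"
    unfolding energy_def by (auto intro!: derivative_eq_intros f_has_derivative f'_has_derivative)
  then show ?thesis unfolding f''_0 sin_double by (simp add: algebra_simps power2_eq_square)
qed

lemma energy_antimono: "x \<le> y \<Longrightarrow> energy y \<le> energy x"
proof (rule DERIV_nonpos_imp_nonincreasing[where f=energy])
  fix x show "\<exists>z. (energy has_real_derivative z) (at x) \<and> z \<le> 0"
    using energy_has_derivative[of x] m0_ge by (intro exI[of _ "- (real m0 - 1) * (f' 0 x)\<^sup>2"]) (auto intro!: mult_nonpos_nonneg)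
qed

text \<open>
  The energy decreases from its limit \<open>0\<close> at minus infinity. If it were still \<open>0\<close> at some point, the
  velocity would vanish before it and the solution would be constant there.
\<close>

lemma energy_neg: "energy x < 0"
proof -
  have "(energy \<longlongrightarrow> 0\<^sup>2 / 2 - real m0 / 2 * (sin 0)\<^sup>2) at_bot"
    unfolding energy_def by (intro tendsto_intros f_tendsto_0 f'_tendsto_0) auto
  then have lim: "(energy \<longlongrightarrow> 0) at_bot" by simp
  have le: "energy x \<le> 0" for x
  proof (rule tendsto_lowerbound[OF lim])
    show "\<forall>\<^sub>F y in at_bot. energy x \<le> energy y"
      unfolding eventually_at_bot_linorder using energy_antimono by blast
  qed simp
  moreover have "energy x \<noteq> 0"
  proof
    assume 0: "energy x = 0"
    have E0: "energy y = 0" if "y \<le> x" for y using le[of y] energy_antimono[OF that] 0 by simp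
    have f'0: "f' 0 y = 0" if "y < x" for y
    proof -
      have "(energy has_real_derivative 0) (at y)"
        by (rule has_field_derivative_transform_within_open[of "\<lambda>_. 0::real" 0 y "{..<x}" energy])
          (use E0 that in auto)
      then have "- (real m0 - 1) * (f' 0 y)\<^sup>2 = 0" by (rule DERIV_unique[OF energy_has_derivative])
      then show ?thesis using m0_ge by simp
    qed
    obtain N where N: "\<And>y. y \<le> N \<Longrightarrow> f 0 y > 0"
      using f_pos_near_bot[of 0] unfolding eventually_at_bot_linorder by blast
    define b where "b = min N (x - 1)"
    have const: "f 0 y = f 0 b" if "y < b" for y
    proof (rule DERIV_isconst_end[OF that continuous_on_f_q, symmetric])
      fix w assume "y < w" "w < b"
      then have "w < x" by (simp add: b_def)
      then show "(f 0 has_real_derivative 0) (at w)" using f_has_derivative[of 0 w] f'0 by simp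
    qed
    have "((\<lambda>_::real. f 0 b) \<longlongrightarrow> 0) at_bot"
    proof (rule Lim_transform_eventually[OF f_tendsto_0[of 0]])
      show "\<forall>\<^sub>F y in at_bot. f 0 y = f 0 b"
        unfolding eventually_at_bot_dense using const by blast
    qed
    then have "f 0 b = 0" by (simp add: tendsto_const_iff)
    then show False using N[of b] by (simp add: b_def)
  qed
  ultimately show ?thesis by (simp add: less_le)
qed

text \<open>
  A solution reaching a multiple of \<open>pi\<close> would have nonnegative energy.
\<close>

lemma f_0_range: "0 < f 0 x" "f 0 x < pi"
proof -
  have no: "sin (f 0 y) \<noteq> 0" for y
    using energy_neg[of y] by (auto simp: energy_def)
  obtain N where N: "\<And>y. y \<le> N \<Longrightarrow> f 0 y > 0"
    using f_pos_near_bot[of 0] unfolding eventually_at_bot_linorder by blast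
  define b where "b = Min {N, 0, x}"
  have "b \<le> N" "b \<le> 0" "b \<le> x" by (auto simp: b_def)
  then have b: "b \<le> x" "0 < f 0 b" "f 0 b < pi"
    using N[of b] f_le_1[of b 0] pi_gt3 by linarith+
  show "0 < f 0 x"
  proof (rule ccontr)
    assume "\<not> ?thesis"
    then have "\<exists>y. b \<le> y \<and> y \<le> x \<and> f 0 y = 0" using b by (intro IVT2' continuous_on_f_q) auto
    then show False using no by (metis sin_zero)
  qed
  show "f 0 x < pi"
  proof (rule ccontr)
    assume "\<not> ?thesis"
    then have "\<exists>y. b \<le> y \<and> y \<le> x \<and> f 0 y = pi" using b by (intro IVT' continuous_on_f_q) auto
    then show False using no by (metis sin_pi)
  qed
qed

lemma f_0_tendsto: "(f 0 \<longlongrightarrow> pi / 2) at_top"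
proof (rule tendsto_pi_half_if_cos_tendsto_0)
  show "\<forall>\<^sub>F x in at_top. 0 < f 0 x \<and> f 0 x < pi" using f_0_range by simp
  have sin2: "((\<lambda>x. sin (2 * f 0 x)) \<longlongrightarrow> 0) at_top"
  proof (rule pendulum_settles(2)[where X=0 and \<beta>="\<lambda>_. real m0 - 1" and A="\<lambda>_. real m0" and V="\<lambda>x. - energy x"
        and V'="\<lambda>x. (real m0 - 1) * (f' 0 x)\<^sup>2" and \<gamma>="real m0 - 1" and ?A0.0="real m0" and ?A1.0="real m0"
        and B="real m0" and W="real m0" and Vmax="real m0 / 2" and y'="f' 0"])
    fix x :: real
    show "(f 0 has_real_derivative f' 0 x) (at x)" by (rule f_has_derivative)
    show "(f' 0 has_real_derivative - (real m0 - 1) * f' 0 x + real m0 / 2 * sin (2 * f 0 x)) (at x)"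
      using f'_has_derivative[of 0 x] by (simp add: f''_0)
    show "((\<lambda>x. - energy x) has_real_derivative (real m0 - 1) * (f' 0 x)\<^sup>2) (at x)"
      using DERIV_minus[OF energy_has_derivative[of x]] by (simp add: algebra_simps)
    have s: "real m0 * (sin (f 0 x))\<^sup>2 \<le> real m0 * 1" by (intro mult_left_mono) (auto simp: abs_square_le_1)
    have "0 \<le> (f' 0 x)\<^sup>2" by simp
    then show "- energy x \<le> real m0 / 2" using s unfolding energy_def by linarith
    have "(f' 0 x)\<^sup>2 \<le> real m0 * 1" using energy_neg[of x] s unfolding energy_def by linarith
    also have "\<dots> \<le> (real m0)\<^sup>2" using m0_ge by (simp add: power2_eq_square)
    finally show "\<bar>f' 0 x\<bar> \<le> real m0" by (simp add: abs_le_square_iff[symmetric])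
  qed (use m0_ge in auto)
  define \<eta> where "\<eta> = sqrt (- 2 * energy 0 / real m0)"
  have \<eta>: "\<eta> > 0" using energy_neg[of 0] m0_ge by (simp add: \<eta>_def divide_neg_pos)
  have lim: "((\<lambda>x. \<bar>sin (2 * f 0 x)\<bar> / (2 * \<eta>)) \<longlongrightarrow> 0) at_top"
    using tendsto_divide[OF tendsto_rabs_zero[OF sin2] tendsto_const, of "2 * \<eta>"] \<eta> by simp
  have "norm (cos (f 0 x)) \<le> \<bar>sin (2 * f 0 x)\<bar> / (2 * \<eta>)" if "x \<ge> 0" for x
  proof -
    have s: "sin (f 0 x) > 0" using f_0_range[of x] by (simp add: sin_gt_zero)
    have "0 \<le> (f' 0 x)\<^sup>2" by simp
    then have "- 2 * energy 0 \<le> real m0 * (sin (f 0 x))\<^sup>2" using energy_antimono[OF that] unfolding energy_def[of x] by linarith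
    then have "- 2 * energy 0 / real m0 \<le> (sin (f 0 x))\<^sup>2" using m0_ge by (simp add: field_simps)
    then have "\<eta> \<le> sin (f 0 x)" unfolding \<eta>_def using s by (intro real_le_lsqrt) auto
    then have "\<bar>cos (f 0 x)\<bar> * \<eta> \<le> \<bar>cos (f 0 x)\<bar> * sin (f 0 x)" by (intro mult_left_mono) auto
    also have "\<dots> = \<bar>sin (2 * f 0 x)\<bar> / 2" unfolding sin_double using s by (simp add: abs_mult)
    finally show ?thesis using \<eta> by (simp add: field_simps)
  qed
  then show "((\<lambda>x. cos (f 0 x)) \<longlongrightarrow> 0) at_top"
    by (intro Lim_null_comparison[OF _ lim]) (auto simp: eventually_at_top_linorder)
qed

text \<open>
  Near the limit \<open>pi / 2\<close> the deviation satisfies a damped oscillator equation with friction \<open>m0 - 1\<close>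
  and stiffness close to \<open>m0\<close>. It oscillates since \<open>(m0 - 1)\<^sup>2 < 4 m0\<close>, which is where \<open>m0 \<le> 5\<close> is used.
\<close>

lemma f_0_node_beyond: "\<exists>x\<ge>X. f 0 x = pi / 2"
proof -
  define sc where "sc w = (if w = 0 then 1 else sin w / w)" for w :: real
  define \<phi> where "\<phi> x = f 0 x - pi / 2" for x
  define b where "b = real m0 - 1"
  \<comment> \<open>halfway between the critical and the limiting stiffness\<close>
  define \<kappa>0 where "\<kappa>0 = (b\<^sup>2 / 4 + real m0) / 2"
  have osc: "b\<^sup>2 / 4 < real m0"
  proof -
    have "real m0 \<in> {2, 3, 4, 5}" using m0_ge m0_le by auto
    then show ?thesis unfolding b_def by (auto simp: power2_eq_square)
  qed
  have "((\<lambda>w::real. sin w / w) \<longlongrightarrow> 1) (at 0)"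
    using DERIV_sin[of "0::real"] by (simp add: has_field_derivative_iff)
  moreover have "\<forall>\<^sub>F w in at 0. sin w / w = sc w" by (auto simp: eventually_at_filter sc_def)
  ultimately have "(sc \<longlongrightarrow> 1) (at 0)" using Lim_transform_eventually by blast
  then have "isCont sc 0" by (simp add: isCont_def sc_def)
  moreover have \<phi>0: "((\<lambda>x. 2 * \<phi> x) \<longlongrightarrow> 0) at_top"
    unfolding \<phi>_def using tendsto_mult_right_zero[OF LIM_zero[OF f_0_tendsto], of 2] by simp
  ultimately have "((\<lambda>x. real m0 * sc (2 * \<phi> x)) \<longlongrightarrow> real m0 * sc 0) at_top"
    by (intro tendsto_intros) (rule isCont_tendsto_compose)
  then have "\<forall>\<^sub>F x in at_top. \<kappa>0 < real m0 * sc (2 * \<phi> x)"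
    using osc by (intro order_tendstoD) (auto simp: sc_def \<kappa>0_def)
  then obtain Y where Y: "\<And>x. x \<ge> Y \<Longrightarrow> \<kappa>0 < real m0 * sc (2 * \<phi> x)"
    unfolding eventually_at_top_linorder by blast
  have "\<exists>x\<ge>max X Y. \<phi> x = 0"
  proof (rule underdamped_has_zero[where y'="f' 0" and b=b and \<kappa>="\<lambda>x. real m0 * sc (2 * \<phi> x)" and ?\<kappa>0.0=\<kappa>0])
    fix x assume x: "x \<ge> max X Y"
    show "(\<phi> has_real_derivative f' 0 x) (at x)"
      unfolding \<phi>_def by (auto intro!: derivative_eq_intros f_has_derivative)
    have "sin (2 * f 0 x) = - sin (2 * \<phi> x)" by (simp add: \<phi>_def sin_diff algebra_simps)
    moreover have "sc (2 * \<phi> x) * (2 * \<phi> x) = sin (2 * \<phi> x)" by (auto simp: sc_def)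
    ultimately have "f'' 0 x = - b * f' 0 x - real m0 * sc (2 * \<phi> x) * \<phi> x"
      unfolding f''_0 b_def by (simp add: algebra_simps)
    then show "(f' 0 has_real_derivative - b * f' 0 x - real m0 * sc (2 * \<phi> x) * \<phi> x) (at x)"
      using f'_has_derivative[of 0 x] by simp
    show "\<kappa>0 \<le> real m0 * sc (2 * \<phi> x)" using Y[of x] x by simp
  qed (use osc in \<open>simp add: \<kappa>0_def\<close>)
  then show ?thesis by (auto simp: \<phi>_def)
qed

lemma infinite_nodes_0: "infinite {x. f 0 x = pi / 2}"
proof
  assume "finite {x. f 0 x = pi / 2}"
  then have "bdd_above {x. f 0 x = pi / 2}" by simp
  then obtain M where M: "\<And>x. f 0 x = pi / 2 \<Longrightarrow> x \<le> M" unfolding bdd_above_def by blast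
  obtain x where "x \<ge> M + 1" "f 0 x = pi / 2" using f_0_node_beyond by blast
  then show False using M[of x] by simp
qed

section \<open>Behaviour at the far end\<close>

lemma real_n: "real n = real m0 + real m1 - 2" using m0_ge m1_ge by (simp add: n_def of_nat_diff)

text \<open>
  As \<open>x\<close> tends to infinity, the friction and the gravity of the pendulum both change sign. Measured
  from \<open>pi / 2\<close> it becomes a pendulum with gravity \<open>gravity > 0\<close> and negative friction. Dividing its
  kinetic energy by the slowly varying gravity gives an energy that increases as soon as
  \<open>in_tail\<close> holds.
\<close>

definition N :: real where "N = real (n + 2)"
definition gravity :: "real \<Rightarrow> real \<Rightarrow> real" where "gravity q x = N * S q x - real m0"
definition tail_energy :: "real \<Rightarrow> real \<Rightarrow> real" where "tail_energy q x = (f' q x)\<^sup>2 / (2 * gravity q x) - (cos (f q x))\<^sup>2 / 2"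
definition tail_energy' :: "real \<Rightarrow> real \<Rightarrow> real" where
  "tail_energy' q x = (f' q x)\<^sup>2 * ((- (real m0 - 1 - real n * S q x) - N * (2 * S q x * (1 - S q x)) / (2 * gravity q x)) / gravity q x)"
definition in_tail :: "real \<Rightarrow> real \<Rightarrow> bool" where "in_tail q x \<longleftrightarrow> N * (1 - S q x) \<le> 1 / 8"

lemma N_eq: "N = real m0 + real m1" unfolding N_def by (simp add: real_n)

lemma N_ge: "N \<ge> 4" unfolding N_eq using m0_ge m1_ge by linarith

lemma S_has_derivative: "(S q has_real_derivative 2 * S q x * (1 - S q x)) (at x)"
proof -
  define w where "w = 1 + lam q * (exp x)\<^sup>2"
  have w: "w \<noteq> 0" unfolding w_def by simp
  have "(S q has_real_derivative (2 * lam q * (exp x)\<^sup>2 * w - lam q * (exp x)\<^sup>2 * (2 * lam q * (exp x)\<^sup>2)) / (w * w)) (at x)"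
    unfolding S_def sin_sq_def w_def using denom_neq_0[of q "exp x"]
    by (auto intro!: derivative_eq_intros simp: power2_eq_square)
  moreover have "(2 * lam q * (exp x)\<^sup>2 * w - lam q * (exp x)\<^sup>2 * (2 * lam q * (exp x)\<^sup>2)) / (w * w) = 2 * S q x * (1 - S q x)"
  proof -
    have 1: "S q x = lam q * (exp x)\<^sup>2 / w" by (simp add: S_def sin_sq_def w_def)
    have 2: "1 - S q x = 1 / w" unfolding 1 using w by (simp add: field_simps) (simp add: w_def)
    have 3: "2 * lam q * (exp x)\<^sup>2 * w - lam q * (exp x)\<^sup>2 * (2 * lam q * (exp x)\<^sup>2) = 2 * lam q * (exp x)\<^sup>2"
      by (simp add: w_def algebra_simps)
    show ?thesis unfolding 2 3 unfolding 1 by simp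
  qed
  ultimately show ?thesis by simp
qed

lemma tail_coefficients:
  assumes "in_tail q x"
  shows "1 \<le> gravity q x" "gravity q x \<le> N" "(f' q x)\<^sup>2 / (2 * N) \<le> tail_energy' q x"
proof -
  define d where "d = 1 - S q x"
  have d: "0 \<le> d" "d \<le> 1" "N * d \<le> 1 / 8" using S_bounds[of q x] assms by (auto simp: d_def in_tail_def)
  have Sd: "S q x = 1 - d" by (simp add: d_def)
  have A: "gravity q x = real m1 - N * d" unfolding gravity_def Sd N_eq by (simp add: algebra_simps)
  show A1: "1 \<le> gravity q x" unfolding A using d m1_ge by linarith
  have "0 \<le> N * d" using d N_ge by simp
  then show AN: "gravity q x \<le> N" unfolding A N_eq[symmetric] using N_eq by linarith
  have "real n * d \<le> N * d" using d by (intro mult_right_mono) (auto simp: N_def)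
  then have \<beta>: "- (real m0 - 1 - real n * S q x) \<ge> 7 / 8"
    unfolding Sd using d m1_ge real_n by (simp add: right_diff_distrib)
  have "N * (2 * S q x * (1 - S q x)) \<le> N * (2 * 1 * d)"
    unfolding Sd using d N_ge by (intro mult_left_mono mult_mono) auto
  also have "\<dots> \<le> 1 / 4" using d(3) by simp
  finally have "N * (2 * S q x * (1 - S q x)) / (2 * gravity q x) \<le> (1 / 4) / 2"
    using A1 by (intro frac_le) auto
  then have 1: "1 / 2 \<le> - (real m0 - 1 - real n * S q x) - N * (2 * S q x * (1 - S q x)) / (2 * gravity q x)"
    using \<beta> by linarith
  have "1 / (2 * N) \<le> (1 / 2) / gravity q x" using AN A1 by (simp add: frac_le)
  also have "\<dots> \<le> (- (real m0 - 1 - real n * S q x) - N * (2 * S q x * (1 - S q x)) / (2 * gravity q x)) / gravity q x"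
    using 1 A1 by (intro divide_right_mono) auto
  finally have "(f' q x)\<^sup>2 * (1 / (2 * N)) \<le> tail_energy' q x" unfolding tail_energy'_def by (intro mult_left_mono) auto
  then show "(f' q x)\<^sup>2 / (2 * N) \<le> tail_energy' q x" by simp
qed

lemma tail_energy_has_derivative:
  assumes "in_tail q x"
  shows "(tail_energy q has_real_derivative tail_energy' q x) (at x)"
proof -
  define a where "a = gravity q x"
  define b where "b = N * (2 * S q x * (1 - S q x))"
  define \<beta> where "\<beta> = real m0 - 1 - real n * S q x"
  have a: "a \<noteq> 0" using tail_coefficients(1)[OF assms] by (simp add: a_def)
  have dA: "(gravity q has_real_derivative b) (at x)"
    unfolding gravity_def b_def by (auto intro!: derivative_eq_intros S_has_derivative)
  have "(tail_energy q has_real_derivative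
      (2 * f' q x * f'' q x * (2 * a) - (f' q x)\<^sup>2 * (2 * b)) / ((2 * a) * (2 * a)) + cos (f q x) * sin (f q x) * f' q x) (at x)"
    unfolding tail_energy_def using a unfolding a_def
    by (auto intro!: derivative_eq_intros f_has_derivative f'_has_derivative dA)
  moreover have f'': "f'' q x = - \<beta> * f' q x - a * (sin (f q x) * cos (f q x))"
    unfolding f''_def \<beta>_def a_def gravity_def N_def sin_double by (simp add: field_simps)
  have "(2 * f' q x * f'' q x * (2 * a) - (f' q x)\<^sup>2 * (2 * b)) / ((2 * a) * (2 * a)) + cos (f q x) * sin (f q x) * f' q x = tail_energy' q x"
    unfolding tail_energy'_def a_def[symmetric] b_def[symmetric] \<beta>_def[symmetric] f''
    using a by (simp add: field_simps power2_eq_square)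
  ultimately show ?thesis by simp
qed

lemma tail_energy_mono:
  assumes T: "\<And>y. y \<ge> X \<Longrightarrow> in_tail q y" and "X \<le> x" "x \<le> y"
  shows "tail_energy q x \<le> tail_energy q y"
proof (rule DERIV_nonneg_imp_nondecreasing[where f="tail_energy q", OF \<open>x \<le> y\<close>])
  fix s assume "x \<le> s"
  then have t: "in_tail q s" using T assms by auto
  have "0 \<le> (f' q s)\<^sup>2 / (2 * N)" using N_ge by simp
  then show "\<exists>D. (tail_energy q has_real_derivative D) (at s) \<and> D \<ge> 0"
    using tail_energy_has_derivative[OF t] tail_coefficients(3)[OF t] by (intro exI[of _ "tail_energy' q s"]) auto
qed

lemma f'_sq_eq:
  assumes "in_tail q x"
  shows "(f' q x)\<^sup>2 = gravity q x * (2 * tail_energy q x + (cos (f q x))\<^sup>2)"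
  using tail_coefficients(1)[OF assms] by (simp add: tail_energy_def field_simps)

lemma f'_nonzero:
  assumes "in_tail q x" "tail_energy q x > 0"
  shows "2 * tail_energy q x \<le> (f' q x)\<^sup>2" "f' q x \<noteq> 0"
proof -
  have "1 * (2 * tail_energy q x + 0) \<le> gravity q x * (2 * tail_energy q x + (cos (f q x))\<^sup>2)"
    using tail_coefficients(1)[OF assms(1)] assms(2) by (intro mult_mono add_mono) auto
  then show *: "2 * tail_energy q x \<le> (f' q x)\<^sup>2" unfolding f'_sq_eq[OF assms(1)] by simp
  then show "f' q x \<noteq> 0" using assms(2) by auto
qed

lemma tail_energy_pos_at_node:
  assumes "in_tail q x" "f q x = pi / 2"
  shows "tail_energy q x > 0"
  using tail_coefficients(1)[OF assms(1)] node_simple[OF assms(2)] by (simp add: tail_energy_def assms(2))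

lemma f'_sign_constant:
  assumes T: "\<And>y. y \<ge> X \<Longrightarrow> in_tail q y" and X: "X \<le> x" "x \<le> y" and energy_cond: "tail_energy q x > 0"
  shows "f' q x * f' q y > 0"
proof (rule ccontr)
  have nz: "f' q s \<noteq> 0" if "x \<le> s" for s
    using f'_nonzero(2)[OF T] tail_energy_mono[OF T X(1) that] that X energy_cond by auto
  assume "\<not> ?thesis"
  then have le: "f' q x * f' q y \<le> 0" by simp
  have "\<exists>s\<ge>x. s \<le> y \<and> f' q x * f' q s = 0"
    using X le by (intro IVT2' continuous_intros continuous_on_f'_q) auto
  then show False using nz[of x] nz by auto
qed

lemma f_mvt: assumes "x < y" shows "\<exists>s. x < s \<and> s < y \<and> f q y - f q x = (y - x) * f' q s"
  using MVT2[OF assms, of "f q" "f' q"] f_has_derivative by blast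

text \<open>
  A node forces positive tail energy, hence a velocity that never changes sign afterwards.
\<close>

lemma at_most_one_node_in_tail:
  assumes T: "\<And>y. y \<ge> X \<Longrightarrow> in_tail q y" and x: "X \<le> x" "f q x = pi / 2" and y: "x < y" "f q y = pi / 2"
  shows False
proof -
  obtain s where s: "x < s" "s < y" "f q y - f q x = (y - x) * f' q s" using f_mvt[OF y(1)] by blast
  then have "f' q s = 0" using x y by simp
  moreover have "f' q x * f' q s > 0"
    by (rule f'_sign_constant[OF T x(1)]) (use s tail_energy_pos_at_node T x in auto)
  ultimately show False by simp
qed

text \<open>
  A solution that moves away from \<open>pi / 2\<close> with positive tail energy can never turn around. The
  hypothesis is open in all variables, so it is inherited by solutions with nearby parameters.
\<close>

lemma no_node_when_escaping:
  assumes T: "\<And>y. y \<ge> X \<Longrightarrow> in_tail q y" and x: "X \<le> x" "tail_energy q x > 0" "(f q x - pi / 2) * f' q x > 0"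
    and y: "x \<le> y"
  shows "f q y \<noteq> pi / 2"
proof
  assume fy: "f q y = pi / 2"
  have "x \<noteq> y"
  proof
    assume "x = y"
    then have "(f q x - pi / 2) * f' q x = 0" by (simp only: fy diff_self mult_zero_left)
    with x(3) show False by (simp only: less_irrefl)
  qed
  then have "x < y" using y by simp
  then obtain s where s: "x < s" "s < y" "f q y - f q x = (y - x) * f' q s" using f_mvt by blast
  have "f' q x * f' q s > 0" by (rule f'_sign_constant[OF T x(1)]) (use s x in auto)
  then have "(f q x - pi / 2) * f' q s > 0"
    using x(3) by (auto simp: zero_less_mult_iff)
  moreover have "(f q x - pi / 2) = - ((y - x) * f' q s)" using s fy by simp
  ultimately have "- ((y - x) * (f' q s)\<^sup>2) > 0" by (simp add: power2_eq_square algebra_simps)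
  moreover have "(y - x) * (f' q s)\<^sup>2 \<ge> 0" using \<open>x < y\<close> by simp
  ultimately show False by linarith
qed

text \<open>
  Positive tail energy keeps the speed above a positive constant, so the solution eventually leaves \<open>pi / 2\<close> behind.
\<close>

lemma escapes_if_tail_energy_pos:
  assumes T: "\<And>y. y \<ge> X \<Longrightarrow> in_tail q y" and x: "X \<le> x" "tail_energy q x > 0"
  shows "\<exists>y\<ge>x. tail_energy q y > 0 \<and> (f q y - pi / 2) * f' q y > 0"
proof -
  define c where "c = sqrt (2 * tail_energy q x)"
  have c: "c > 0" "c\<^sup>2 = 2 * tail_energy q x" using x by (auto simp: c_def)
  have big: "\<bar>f' q s\<bar> \<ge> c" if "s \<ge> x" for s
  proof -
    have energy_cond: "tail_energy q x \<le> tail_energy q s" by (rule tail_energy_mono[OF T x(1) that])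
    have "c\<^sup>2 \<le> (f' q s)\<^sup>2" using f'_nonzero(1)[of q s] T[of s] energy_cond x that c by auto
    then have "\<bar>c\<bar> \<le> \<bar>f' q s\<bar>" by (simp only: abs_le_square_iff)
    then show ?thesis using c(1) by simp
  qed
  define \<sigma> where "\<sigma> = sgn (f' q x)"
  have \<sigma>: "\<sigma> * f' q s = \<bar>f' q s\<bar>" if "s \<ge> x" for s
  proof -
    have "f' q x * f' q s > 0" by (rule f'_sign_constant[OF T x(1) that x(2)])
    then show ?thesis unfolding \<sigma>_def by (auto simp: zero_less_mult_iff sgn_if)
  qed
  have \<sigma>1: "\<bar>\<sigma>\<bar> \<le> 1" by (simp add: \<sigma>_def sgn_if)
  \<comment> \<open>at speed \<open>c\<close> this time is enough to be past \<open>pi / 2\<close> in the direction of motion\<close>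
  define y where "y = x + (\<bar>f q x - pi / 2\<bar> + 1) / c"
  have y: "x < y" "(y - x) * c = \<bar>f q x - pi / 2\<bar> + 1" using c by (auto simp: y_def add_nonneg_pos)
  obtain s where s: "x < s" "s < y" "f q y - f q x = (y - x) * f' q s" using f_mvt[OF y(1)] by blast
  have combine: "0 < a" if "a = g + t" "K \<le> t" "\<bar>g\<bar> \<le> 1 * d" "K = d + 1" for a g t K d :: real
    using that by linarith
  have "\<sigma> * (f q y - pi / 2) = \<sigma> * (f q x - pi / 2) + (y - x) * (\<sigma> * f' q s)"
  proof -
    have fy: "f q y = f q x + (y - x) * f' q s" using s(3) by simp
    show ?thesis unfolding fy by (simp add: algebra_simps)
  qed
  moreover have "(y - x) * (\<sigma> * f' q s) \<ge> (y - x) * c"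
    using \<sigma>[of s] big[of s] s y by (intro mult_left_mono) auto
  moreover have "\<bar>\<sigma> * (f q x - pi / 2)\<bar> \<le> 1 * \<bar>f q x - pi / 2\<bar>"
    unfolding abs_mult using \<sigma>1 by (intro mult_right_mono) auto
  ultimately have 1: "\<sigma> * (f q y - pi / 2) > 0" using y(2) by (rule combine)
  have 2: "\<sigma> * f' q y > 0" using \<sigma>[of y] big[of y] y c by auto
  have "(f q y - pi / 2) * f' q y > 0" using 1 2 by (auto simp: zero_less_mult_iff)
  moreover have "tail_energy q y > 0" using tail_energy_mono[OF T x(1), of y] y x by auto
  ultimately show ?thesis using y by (intro exI[of _ y]) auto
qed

text \<open>
  A solution that never gains enough energy to pass over a saddle has bounded velocity and settles, so
  \<open>f'\<close> and \<open>sin (2 f)\<close> tend to \<open>0\<close>. It cannot settle at the minimum of the potential: there the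
  tail energy is \<open>- 1 / 2\<close>, while it starts above this value and increases. What remains are the saddles, where \<open>cos f = 0\<close>.
\<close>

lemma converges_if_tail_energy_nonpos:
  assumes T: "\<And>y. y \<ge> X \<Longrightarrow> in_tail q y" and energy_cond: "\<And>y. y \<ge> X \<Longrightarrow> tail_energy q y \<le> 0"
  shows "\<exists>l::int. (f q \<longlongrightarrow> (2 * real_of_int l + 1) * (pi / 2)) at_top"
proof (rule tendsto_odd_pi_half_if_cos_tendsto_0[OF continuous_on_f_q])
  have sin2: "sin (2 * (f q x - pi / 2)) = - sin (2 * f q x)" for x by (simp add: sin_diff algebra_simps)
  note settle = pendulum_settles[where X=X and y="\<lambda>x. f q x - pi / 2" and y'="f' q"
      and \<beta>="\<lambda>x. real m0 - 1 - real n * S q x" and A="gravity q" and ?A0.0=1 and ?A1.0=N and B=N and W=N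
      and V="tail_energy q" and V'="tail_energy' q" and \<gamma>="1 / (2 * N)" and Vmax=0]
  have prem: "((\<lambda>x. f q x - pi / 2) has_real_derivative f' q x) (at x)"
    "(f' q has_real_derivative - (real m0 - 1 - real n * S q x) * f' q x + gravity q x / 2 * sin (2 * (f q x - pi / 2))) (at x)"
    "1 \<le> gravity q x" "gravity q x \<le> N" "\<bar>real m0 - 1 - real n * S q x\<bar> \<le> N" "\<bar>f' q x\<bar> \<le> N"
    "(tail_energy q has_real_derivative tail_energy' q x) (at x)" "1 / (2 * N) * (f' q x)\<^sup>2 \<le> tail_energy' q x" "tail_energy q x \<le> 0"
    if x: "x \<ge> X" for x
  proof -
    show "((\<lambda>x. f q x - pi / 2) has_real_derivative f' q x) (at x)"
      by (auto intro!: derivative_eq_intros f_has_derivative)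
    have "f'' q x = - (real m0 - 1 - real n * S q x) * f' q x + gravity q x / 2 * sin (2 * (f q x - pi / 2))"
      unfolding sin2 f''_def gravity_def N_def by (simp add: algebra_simps)
    then show "(f' q has_real_derivative - (real m0 - 1 - real n * S q x) * f' q x + gravity q x / 2 * sin (2 * (f q x - pi / 2))) (at x)"
      using f'_has_derivative[of q x] by simp
    show A: "1 \<le> gravity q x" "gravity q x \<le> N" by (rule tail_coefficients[OF T[OF x]])+
    have "0 \<le> real n * S q x" "real n * S q x \<le> real n"
      using S_bounds[of q x] by (auto intro!: mult_nonneg_nonneg mult_left_le)
    then show "\<bar>real m0 - 1 - real n * S q x\<bar> \<le> N"
      using m0_ge m1_ge real_n N_eq unfolding abs_le_iff by linarith
    have "(f' q x)\<^sup>2 \<le> gravity q x * 1"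
      unfolding f'_sq_eq[OF T[OF x]]
    proof (rule mult_left_mono)
      have "(cos (f q x))\<^sup>2 \<le> 1" by (simp add: abs_square_le_1)
      then show "2 * tail_energy q x + (cos (f q x))\<^sup>2 \<le> 1" using energy_cond[OF x] by linarith
    qed (use A in simp)
    also have "\<dots> \<le> N" using A by simp
    also have "\<dots> \<le> N\<^sup>2" using N_ge by (simp add: power2_eq_square)
    finally show "\<bar>f' q x\<bar> \<le> N" using N_ge by (simp add: abs_le_square_iff[symmetric])
    show "(tail_energy q has_real_derivative tail_energy' q x) (at x)" by (rule tail_energy_has_derivative[OF T[OF x]])
    show "1 / (2 * N) * (f' q x)\<^sup>2 \<le> tail_energy' q x" using tail_coefficients(3)[OF T[OF x]] by simp
    show "tail_energy q x \<le> 0" by (rule energy_cond[OF x])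
  qed
  have Npos: "0 < 1 / (2 * N)" using N_ge by simp
  have f'0: "(f' q \<longlongrightarrow> 0) at_top" by (rule settle(1)) (use prem Npos in auto)
  have s0: "((\<lambda>x. sin (2 * (f q x - pi / 2))) \<longlongrightarrow> 0) at_top" by (rule settle(2)) (use prem Npos in auto)
  then have s0: "((\<lambda>x. sin (2 * f q x)) \<longlongrightarrow> 0) at_top" unfolding sin2 using tendsto_minus by fastforce
  \<comment> \<open>the height above the minimum of the potential, positive because the solution is not at rest\<close>
  define \<eta> where "\<eta> = tail_energy q X + 1 / 2"
  have \<eta>: "\<eta> > 0"
  proof (rule ccontr)
    assume "\<not> ?thesis"
    moreover have c: "(cos (f q X))\<^sup>2 \<le> 1" by (simp add: abs_square_le_1)
    moreover have p: "0 \<le> (f' q X)\<^sup>2 / (2 * gravity q X)" using tail_coefficients(1)[OF T[OF order_refl]] by simp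
    ultimately have "(f' q X)\<^sup>2 / (2 * gravity q X) = 0" and "(cos (f q X))\<^sup>2 = 1"
      unfolding \<eta>_def tail_energy_def by linarith+
    then have "f' q X = 0" "sin (2 * f q X) = 0"
      using tail_coefficients(1)[OF T[OF order_refl]] sin_cos_squared_add[of "f q X"] by (auto simp: sin_double)
    then show False using f_not_at_rest by blast
  qed
  have "\<forall>\<^sub>F x in at_top. (f' q x)\<^sup>2 < \<eta>"
    using order_tendstoD(2)[OF tendsto_power[OF f'0, of 2], of \<eta>] \<eta> by simp
  then have ev: "\<forall>\<^sub>F x in at_top. norm (cos (f q x)) \<le> 1 / (2 * sqrt \<eta>) * \<bar>sin (2 * f q x)\<bar>"
    using eventually_ge_at_top[of X]
  proof eventually_elim
    case (elim x)
    have A: "1 \<le> gravity q x" using tail_coefficients(1)[OF T[OF elim(2)]] .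
    have "(f' q x)\<^sup>2 / (2 * gravity q x) \<le> (f' q x)\<^sup>2 / 2" using A by (intro divide_left_mono) auto
    moreover have "\<eta> - 1 / 2 \<le> tail_energy q x" using tail_energy_mono[OF T _ elim(2)] by (simp add: \<eta>_def)
    ultimately have "\<eta> \<le> (sin (f q x))\<^sup>2"
      using elim(1) sin_cos_squared_add[of "f q x"] unfolding tail_energy_def by linarith
    then have "sqrt \<eta> \<le> \<bar>sin (f q x)\<bar>" by (simp add: real_le_rsqrt real_sqrt_le_iff flip: real_sqrt_abs)
    then have "\<bar>cos (f q x)\<bar> * sqrt \<eta> \<le> \<bar>cos (f q x)\<bar> * \<bar>sin (f q x)\<bar>" by (intro mult_left_mono) auto
    also have "\<dots> = \<bar>sin (2 * f q x)\<bar> / 2" unfolding sin_double by (simp add: abs_mult)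
    finally show ?case using \<eta> by (simp add: field_simps)
  qed
  have "((\<lambda>x. 1 / (2 * sqrt \<eta>) * \<bar>sin (2 * f q x)\<bar>) \<longlongrightarrow> 0) at_top"
    by (rule tendsto_mult_right_zero[OF tendsto_rabs_zero[OF s0]])
  then show "((\<lambda>x. cos (f q x)) \<longlongrightarrow> 0) at_top" by (rule Lim_null_comparison[OF ev])
qed

lemma uniform_tail:
  assumes "0 < p" "p \<le> 1"
  shows "\<exists>X\<ge>0. \<forall>q x. p \<le> q \<longrightarrow> X \<le> x \<longrightarrow> in_tail q x"
proof -
  define X where "X = max 0 (ln (8 * N / p\<^sup>2))"
  have "in_tail q x" if q: "p \<le> q" and x: "X \<le> x" for q x
  proof -
    have "p\<^sup>2 \<le> q\<^sup>2" using q assms by (intro power_mono) auto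
    then have l: "p\<^sup>2 \<le> lam q" using assms by (simp add: lam_def power_le_one)
    have pos: "8 * N / p\<^sup>2 > 0" using N_ge assms by simp
    have "8 * N / p\<^sup>2 = exp (ln (8 * N / p\<^sup>2))" using pos by simp
    also have "\<dots> \<le> exp x" using x by (simp only: exp_le_cancel_iff X_def max.bounded_iff)
    also have "\<dots> \<le> (exp x)\<^sup>2" using x by (simp add: X_def power2_eq_square)
    finally have "8 * N \<le> p\<^sup>2 * (exp x)\<^sup>2" using assms by (simp add: field_simps)
    also have "\<dots> \<le> lam q * (exp x)\<^sup>2" using l by (intro mult_right_mono) auto
    finally have b: "8 * N \<le> 1 + lam q * (exp x)\<^sup>2" by simp
    have eq: "1 - S q x = 1 / (1 + lam q * (exp x)\<^sup>2)" using denom_neq_0[of q "exp x"] unfolding S_def sin_sq_def by (simp add: field_simps)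
    have "N / (1 + lam q * (exp x)\<^sup>2) \<le> N / (8 * N)"
      using N_ge b by (intro divide_left_mono) auto
    also have "\<dots> = 1 / 8" using N_ge by simp
    finally show ?thesis unfolding in_tail_def eq by simp
  qed
  then show ?thesis by (intro exI[of _ X]) (auto simp: X_def)
qed

section \<open>Shooting\<close>

definition nodes :: "real \<Rightarrow> real set" where "nodes q = {x. f q x = pi / 2}"

lemma nodes_nonneg: "x \<in> nodes q \<Longrightarrow> x > 0"
  using f_le_1[of x q] pi_gt3 by (force simp: nodes_def not_less[symmetric])

lemma continuous_on_f_diff: "continuous_on A (\<lambda>(q, x). f q x - pi / 2)"
  using continuous_on_f[of A] unfolding split_def by (intro continuous_intros)

lemma f_diff_has_derivative: "((\<lambda>x. f q x - pi / 2) has_real_derivative f' q x) (at x)"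
  by (auto intro!: derivative_eq_intros f_has_derivative)

text \<open>
  A large \<open>b\<close> does not bound all nodes, since a further node may come in from infinity when the
  parameter changes; this is why the count is restricted to a compact interval.
\<close>

lemma nodes_upper:
  shows "finite (nodes p \<inter> {0..b})"
    and "\<forall>\<^sub>F q in nhds p. card (nodes q \<inter> {0..b}) \<le> card (nodes p \<inter> {0..b})"
proof -
  have eq: "{x \<in> {0..b}. f q x - pi / 2 = 0} = nodes q \<inter> {0..b}" for q by (auto simp: nodes_def)
  have simple: "f' p x \<noteq> 0" if "f p x - pi / 2 = 0" for x using node_simple that by simp
  note up = zero_count_upper_semicontinuous[where S=UNIV and f="\<lambda>q x. f q x - pi / 2" and f'=f' and p=p and a=0 and b=b,
      OF continuous_on_f_diff continuous_on_f' f_diff_has_derivative UNIV_I simple]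
  show "finite (nodes p \<inter> {0..b})" using up(1) unfolding eq .
  show "\<forall>\<^sub>F q in nhds p. card (nodes q \<inter> {0..b}) \<le> card (nodes p \<inter> {0..b})"
    using up(2)
  proof (rule eventually_mono)
    fix q assume *: "q \<in> UNIV \<longrightarrow> finite {x \<in> {0..b}. f q x - pi / 2 = 0} \<and>
        card {x \<in> {0..b}. f q x - pi / 2 = 0} \<le> card {x \<in> {0..b}. f p x - pi / 2 = 0}"
    show "card (nodes q \<inter> {0..b}) \<le> card (nodes p \<inter> {0..b})" using * unfolding eq by blast
  qed
qed

lemma nodes_lower:
  assumes "finite T" "T \<subseteq> nodes p"
  shows "\<forall>\<^sub>F q in nhds p. finite (nodes q) \<longrightarrow> card T \<le> card (nodes q)"
proof -
  have "\<forall>\<^sub>F q in nhds p. q \<in> UNIV \<longrightarrow> (\<exists>T'. finite T' \<and> card T' = card T \<and> (\<forall>z\<in>T'. f q z - pi / 2 = 0))"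
    by (rule simple_zeros_persist[where f'=f', OF continuous_on_f_diff f_diff_has_derivative UNIV_I assms(1)])
      (use assms(2) node_simple in \<open>auto simp: nodes_def\<close>)
  then show ?thesis
  proof (rule eventually_mono, intro impI)
    fix q assume "q \<in> UNIV \<longrightarrow> (\<exists>T'. finite T' \<and> card T' = card T \<and> (\<forall>z\<in>T'. f q z - pi / 2 = 0))" "finite (nodes q)"
    then obtain T' where "finite T'" "card T' = card T" "T' \<subseteq> nodes q" by (auto simp: nodes_def)
    then show "card T \<le> card (nodes q)" using \<open>finite (nodes q)\<close> by (metis card_mono)
  qed
qed

lemma nodes_split: assumes "0 \<le> X" shows "nodes q = (nodes q \<inter> {0..X}) \<union> (nodes q \<inter> {X<..})"
  using nodes_nonneg[of _ q] by force

lemma tail_nodes: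
  assumes T: "\<And>y. y \<ge> X \<Longrightarrow> in_tail q y"
  shows "finite (nodes q \<inter> {X<..})" "card (nodes q \<inter> {X<..}) \<le> 1"
proof -
  have "x = y" if "x \<in> nodes q \<inter> {X<..}" "y \<in> nodes q \<inter> {X<..}" for x y
  proof -
    have "f q x = pi / 2" "f q y = pi / 2" "X \<le> x" "X \<le> y" using that unfolding nodes_def by auto
    then show ?thesis
      using at_most_one_node_in_tail[OF T] by (cases x y rule: linorder_cases) blast+
  qed
  then have "\<exists>z. nodes q \<inter> {X<..} \<subseteq> {z}" by blast
  then obtain z where z: "nodes q \<inter> {X<..} \<subseteq> {z}" by blast
  show "finite (nodes q \<inter> {X<..})" using z finite_subset by blast
  show "card (nodes q \<inter> {X<..}) \<le> 1" using card_mono[OF _ z] by simp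
qed

lemma finite_nodes: assumes "0 < q" "q \<le> 1" shows "finite (nodes q)"
proof -
  obtain X where X: "X \<ge> 0" "\<And>x. X \<le> x \<Longrightarrow> in_tail q x" using uniform_tail[OF assms] by blast
  show ?thesis
    using nodes_split[OF X(1), of q] nodes_upper(1)[of q X] tail_nodes(1)[OF X(2)] by (metis finite_UnI)
qed

lemma nodes_eps: "nodes \<epsilon> = {}"
proof -
  have "f \<epsilon> x \<noteq> pi / 2" for x using arctan_ubound[of "\<epsilon> * exp x"] unfolding f_eps by linarith
  then show ?thesis unfolding nodes_def by blast
qed

text \<open>
  Shooting. Let \<open>p\<close> be the infimum of the parameters with at most \<open>k\<close> nodes. It is positive since
  small parameters have many nodes. Nodes of \<open>f p\<close> persist, so \<open>f p\<close> has at most \<open>k\<close> nodes, while all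
  smaller parameters give at least \<open>k + 1\<close>. Close to \<open>p\<close> the count can exceed that of \<open>p\<close> only by one
  node in the tail, so \<open>f p\<close> has exactly \<open>k\<close>. If \<open>f p\<close> had positive tail energy somewhere, it would
  escape together with its neighbours, the extra node could not occur, and neighbours on the left
  would have at most \<open>k\<close> nodes. So it converges to a saddle.
\<close>

lemma exists_parameter:
  "\<exists>p. 0 < p \<and> p \<le> \<epsilon> \<and> card (nodes p) = k \<and> finite (nodes p) \<and>
    (\<exists>l::int. (f p \<longlongrightarrow> (2 * real_of_int l + 1) * (pi / 2)) at_top)"
proof -
  define Q where "Q = {q. 0 < q \<and> q \<le> \<epsilon> \<and> card (nodes q) \<le> k}"
  define p where "p = Inf Q"
  have fin: "finite (nodes q)" if "0 < q" "q \<le> \<epsilon>" for q using finite_nodes that eps_le by auto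
  obtain T where T: "finite T" "card T = k + 1" "T \<subseteq> nodes 0"
    using infinite_arbitrarily_large[OF infinite_nodes_0] unfolding nodes_def by blast
  obtain d where d: "d > 0" "\<And>q. dist q 0 < d \<Longrightarrow> finite (nodes q) \<Longrightarrow> k + 1 \<le> card (nodes q)"
    using nodes_lower[OF T(1,3)] T(2) unfolding eventually_nhds_metric by auto
  have Qd: "d \<le> q" if "q \<in> Q" for q
  proof (rule ccontr)
    assume "\<not> d \<le> q"
    then show False using d(2)[of q] that fin[of q] by (auto simp: Q_def)
  qed
  have epsQ: "\<epsilon> \<in> Q" using eps_pos by (simp add: Q_def nodes_eps)
  have bdd: "bdd_below Q" using Qd by (rule bdd_belowI)
  have p: "0 < p" "p \<le> \<epsilon>"
    using cInf_greatest[of Q d] Qd epsQ d(1) cInf_lower[OF epsQ bdd] by (force simp: p_def)+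
  have fp: "finite (nodes p)" by (rule fin[OF p])
  have below: "card (nodes q) \<ge> k + 1" if "0 < q" "q < p" for q
  proof (rule ccontr)
    assume "\<not> ?thesis"
    then have "q \<in> Q" using that p by (simp add: Q_def)
    then show False using cInf_lower[OF _ bdd] that by (force simp: p_def)
  qed
  have upper: "card (nodes p) \<le> k"
  proof (rule ccontr)
    assume gt: "\<not> ?thesis"
    obtain e where e: "e > 0" "\<And>q. dist q p < e \<Longrightarrow> finite (nodes q) \<Longrightarrow> card (nodes p) \<le> card (nodes q)"
      using nodes_lower[OF fp order_refl] unfolding eventually_nhds_metric by auto
    obtain q where q: "q \<in> Q" "q < p + e"
      using cInf_less_iff[of Q "p + e"] epsQ bdd e(1) by (auto simp: p_def)
    have "p \<le> q" using cInf_lower[OF q(1) bdd] by (simp add: p_def)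
    then have "dist q p < e" using q(2) by (simp add: dist_real_def)
    then show False using e(2)[of q] q(1) fin[of q] gt by (auto simp: Q_def)
  qed
  obtain X where X: "X \<ge> 0" "\<And>q x. p / 2 \<le> q \<Longrightarrow> X \<le> x \<Longrightarrow> in_tail q x"
    using uniform_tail[of "p / 2"] p eps_le by auto
  have left: "\<exists>q. p / 2 < q \<and> q < p \<and> R q" if "\<forall>\<^sub>F q in nhds p. R q" for R
  proof -
    have "\<forall>\<^sub>F q in at_left p. R q" using that by (simp add: eventually_at_filter eventually_mono)
    moreover have "\<forall>\<^sub>F q in at_left p. q \<in> {p / 2<..<p}" using p by (intro eventually_at_left_real) auto
    ultimately have "\<forall>\<^sub>F q in at_left p. p / 2 < q \<and> q < p \<and> R q" by eventually_elim auto
    then show ?thesis using eventually_happens' trivial_limit_at_left_real by blast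
  qed
  have "card (nodes p) \<ge> k"
  proof -
    obtain q where q: "p / 2 < q" "q < p" "card (nodes q \<inter> {0..X}) \<le> card (nodes p \<inter> {0..X})"
      using left[OF nodes_upper(2)[where p=p and b=X]] by blast
    have "k + 1 \<le> card (nodes q)" using below[of q] q p by simp
    also have "\<dots> \<le> card (nodes q \<inter> {0..X}) + card (nodes q \<inter> {X<..})"
      by (subst nodes_split[OF X(1)]) (rule card_Un_le)
    also have "\<dots> \<le> card (nodes p \<inter> {0..X}) + 1"
      using q tail_nodes(2)[of X q] X(2)[of q] by (intro add_mono) auto
    also have "\<dots> \<le> card (nodes p) + 1" using fp by (intro add_mono card_mono) auto
    finally show ?thesis by simp
  qed
  then have card: "card (nodes p) = k" using upper by simp
  have "tail_energy p x \<le> 0" if x: "x \<ge> X" for x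
  proof (rule ccontr)
    assume "\<not> ?thesis"
    then obtain y where y: "y \<ge> x" "tail_energy p y > 0" "(f p y - pi / 2) * f' p y > 0"
      using escapes_if_tail_energy_pos[of X p x] X(2)[of p] x p by auto
    have y0: "0 \<le> y" "X \<le> y" using X(1) x y by auto
    have contf: "continuous_on UNIV (\<lambda>q. f q y)" "continuous_on UNIV (\<lambda>q. f' q y)"
      unfolding f_def f'_def by (intro continuous_intros)+
    then have isC: "isCont (\<lambda>q. f q y) p" "isCont (\<lambda>q. f' q y) p"
      by (simp_all add: continuous_on_eq_continuous_at)
    have "continuous_on UNIV (\<lambda>q. gravity q y)"
      unfolding gravity_def S_def by (intro continuous_intros)
    then have isA: "isCont (\<lambda>q. gravity q y) p" by (simp add: continuous_on_eq_continuous_at)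
    have A: "gravity p y \<noteq> 0" using tail_coefficients(1)[OF X(2)[of p y]] y0 p by simp
    have ev_pos: "\<forall>\<^sub>F q in nhds p. h q > 0" if "isCont h p" "h p > 0" for h :: "real \<Rightarrow> real"
    proof -
      have "(h \<longlongrightarrow> h p) (nhds p)" using that(1) by (simp add: isCont_def tendsto_at_iff_tendsto_nhds)
      then show ?thesis using that(2) by (rule order_tendstoD(1))
    qed
    have "isCont (\<lambda>q. tail_energy q y) p"
      unfolding tail_energy_def using A by (intro continuous_intros isC isA) auto
    then have 1: "\<forall>\<^sub>F q in nhds p. tail_energy q y > 0"
      using y(2) by (rule ev_pos)
    have "isCont (\<lambda>q. (f q y - pi / 2) * f' q y) p" by (intro continuous_intros isC)
    then have 2: "\<forall>\<^sub>F q in nhds p. (f q y - pi / 2) * f' q y > 0"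
      using y(3) by (rule ev_pos)
    obtain q where q: "p / 2 < q" "q < p" "tail_energy q y > 0" "(f q y - pi / 2) * f' q y > 0"
      "card (nodes q \<inter> {0..y}) \<le> card (nodes p \<inter> {0..y})"
      using left[OF eventually_conj[OF 1 eventually_conj[OF 2 nodes_upper(2)[where p=p and b=y]]]] by blast
    have "nodes q \<inter> {y<..} = {}"
      using no_node_when_escaping[of X q y] X(2)[of q] q y0 by (auto simp: nodes_def)
    then have "nodes q = nodes q \<inter> {0..y}" using nodes_split[OF y0(1), of q] by simp
    then have "card (nodes q) \<le> card (nodes p \<inter> {0..y})" using q(5) by simp
    also have "\<dots> \<le> card (nodes p)" using fp by (intro card_mono) auto
    finally show False using below[of q] q p card by simp
  qed
  then have "\<exists>l::int. (f p \<longlongrightarrow> (2 * real_of_int l + 1) * (pi / 2)) at_top"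
    using converges_if_tail_energy_nonpos[of X p] X(2)[of p] p by auto
  then show ?thesis using p card fp by blast
qed

section \<open>Return to the original variable\<close>

lemma physical_solution:
  assumes p: "0 < p" "p \<le> \<epsilon>"
  shows "ode_solution m0 m1 (\<lambda>t. f p (ln (tan t / p)))"
proof -
  define X where "X t = ln (tan t / p)" for t
  define r where "r t = f p (X t)" for t
  define v where "v t = f' p (X t) / (sin t * cos t)" for t
  have main: "(r has_real_derivative v t) (at t) \<and> (v has_real_derivative ode_rhs m0 m1 t (r t) (v t)) (at t)"
    if t: "t \<in> {0<..<pi / 2}" for t
  proof -
    have sc: "sin t > 0" "cos t > 0" using t by (auto intro: sin_gt_zero2 cos_gt_zero)
    have tan: "tan t > 0" using sc by (simp add: tan_def)
    have X: "(X has_real_derivative 1 / (sin t * cos t)) (at t)"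
    proof -
      have "(X has_real_derivative 1 / (tan t / p) * (inverse ((cos t)\<^sup>2) / p)) (at t)"
        unfolding X_def
        by (rule DERIV_chain2[OF DERIV_ln_divide DERIV_cdivide[OF DERIV_tan]]) (use p sc tan in auto)
      moreover have "1 / (tan t / p) * (inverse ((cos t)\<^sup>2) / p) = 1 / (sin t * cos t)"
        using p sc by (simp add: tan_def field_simps power2_eq_square)
      ultimately show ?thesis by simp
    qed
    have r: "(r has_real_derivative v t) (at t)"
      unfolding r_def v_def using DERIV_chain2[OF f_has_derivative X] by simp
    have dX: "((\<lambda>t. f' p (X t)) has_real_derivative f'' p (X t) * (1 / (sin t * cos t))) (at t)"
      by (rule DERIV_chain2[OF f'_has_derivative X])
    have dsc: "((\<lambda>t. sin t * cos t) has_real_derivative (cos t)\<^sup>2 - (sin t)\<^sup>2) (at t)"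
      by (auto intro!: derivative_eq_intros simp: power2_eq_square)
    have dv: "(v has_real_derivative (f'' p (X t) * (1 / (sin t * cos t)) * (sin t * cos t) - f' p (X t) * ((cos t)\<^sup>2 - (sin t)\<^sup>2))
        / ((sin t * cos t) * (sin t * cos t))) (at t)"
      unfolding v_def using sc by (intro DERIV_divide dX dsc) auto
    have S: "S p (X t) = (sin t)\<^sup>2"
    proof -
      have "exp (X t) = tan t / p" using tan p by (simp add: X_def)
      moreover have "lam p = p\<^sup>2" using p eps_le by (simp add: lam_def abs_square_le_1 power_le_one)
      ultimately have "S p (X t) = (tan t)\<^sup>2 / (1 + (tan t)\<^sup>2)" using p by (simp add: S_def sin_sq_def power_divide)
      also have "\<dots> = (sin t)\<^sup>2 / ((cos t)\<^sup>2 + (sin t)\<^sup>2)" using sc by (simp add: tan_def field_simps power_divide)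
      also have "(cos t)\<^sup>2 + (sin t)\<^sup>2 = 1" by simp
      finally show ?thesis by simp
    qed
    have "(f'' p (X t) * (1 / (sin t * cos t)) * (sin t * cos t) - f' p (X t) * ((cos t)\<^sup>2 - (sin t)\<^sup>2))
        / ((sin t * cos t) * (sin t * cos t)) = ode_rhs m0 m1 t (r t) (v t)"
    proof -
      define s c w a where "s = sin t" and "c = cos t" and "w = f' p (X t)" and "a = sin (2 * f p (X t))"
      have sc': "s \<noteq> 0" "c \<noteq> 0" "c\<^sup>2 = 1 - s\<^sup>2" using sc by (auto simp: s_def c_def cos_squared_eq)
      have f2: "f'' p (X t) = - (real m0 - 1 - (real m0 + real m1 - 2) * s\<^sup>2) * w + (real m0 - (real m0 + real m1) * s\<^sup>2) / 2 * a"
        unfolding f''_def S using N_eq by (simp add: N_def real_n s_def w_def a_def)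
      have csc: "csc (2 * t) = 1 / (2 * s * c)" by (simp add: csc_def sin_double s_def c_def)
      have cot: "cot (2 * t) = (c\<^sup>2 - s\<^sup>2) / (2 * s * c)" by (simp add: cot_def sin_double cos_double s_def c_def)
      have rhs: "ode_rhs m0 m1 t (r t) (v t) =
          ((real m1 - real m0) * (1 / (2 * s * c)) - (real m0 + real m1) * ((c\<^sup>2 - s\<^sup>2) / (2 * s * c))) * (w / (s * c))
          - real m1 * (a / (2 * c\<^sup>2)) + real m0 * (a / (2 * s\<^sup>2))"
        unfolding ode_rhs_def csc cot r_def v_def s_def c_def w_def a_def ..
      have "(s * c)\<^sup>2 * (((real m1 - real m0) * (1 / (2 * s * c)) - (real m0 + real m1) * ((c\<^sup>2 - s\<^sup>2) / (2 * s * c))) * (w / (s * c))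
          - real m1 * (a / (2 * c\<^sup>2)) + real m0 * (a / (2 * s\<^sup>2)))
          = ((real m1 - real m0) - (real m0 + real m1) * (c\<^sup>2 - s\<^sup>2)) / 2 * w - real m1 * s\<^sup>2 * a / 2 + real m0 * c\<^sup>2 * a / 2"
        using sc'(1,2) by (simp add: field_simps power2_eq_square)
      also have "\<dots> = f'' p (X t) - w * (c\<^sup>2 - s\<^sup>2)"
        unfolding sc'(3) f2 by (simp add: field_simps)
      finally have "ode_rhs m0 m1 t (r t) (v t) = (f'' p (X t) - w * (c\<^sup>2 - s\<^sup>2)) / (s * c)\<^sup>2"
        unfolding rhs[symmetric] using sc'(1,2) by (simp add: field_simps)
      then show ?thesis using sc unfolding s_def c_def w_def by (simp add: power2_eq_square)
    qed
    then show ?thesis using r dv by simp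
  qed
  have "deriv r t = v t" if "t \<in> {0<..<pi / 2}" for t using main[OF that] DERIV_imp_deriv by blast
  then have "(deriv r has_real_derivative ode_rhs m0 m1 t (r t) (deriv r t)) (at t)" if "t \<in> {0<..<pi / 2}" for t
    using has_field_derivative_transform_within_open[of v _ t "{0<..<pi / 2}" "deriv r"] main[OF that] that by simp
  moreover have "(r has_real_derivative deriv r t) (at t)" if "t \<in> {0<..<pi / 2}" for t
    using main[OF that] DERIV_imp_deriv by fastforce
  ultimately show ?thesis unfolding ode_solution_def r_def X_def by blast
qed

lemma solution_with_nodes:
  "\<exists>r. bvp_solution m0 m1 r \<and> has_nodal_number r k"
proof -
  obtain p l where p: "0 < p" "p \<le> \<epsilon>" "card (nodes p) = k" "finite (nodes p)"
    and l: "(f p \<longlongrightarrow> (2 * real_of_int l + 1) * (pi / 2)) at_top"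
    using exists_parameter[of k] by blast
  define r where "r t = f p (ln (tan t / p))" for t
  have tan_bot: "filterlim (\<lambda>t. ln (tan t / p)) at_bot (at_right 0)"
    using p(1) by real_asymp
  have tan_top: "filterlim (\<lambda>t. ln (tan t / p)) at_top (at_left (pi / 2))"
  proof -
    have "filterlim (\<lambda>t. tan t * (1 / p)) at_top (at_left (pi / 2))"
      using p(1) by (intro filterlim_at_top_mult_tendsto_pos[OF tendsto_const] filterlim_tan_at_left) auto
    then show ?thesis using filterlim_compose[OF ln_at_top] by fastforce
  qed
  have "bvp_solution m0 m1 r"
    unfolding bvp_solution_def
  proof (intro conjI exI)
    show "ode_solution m0 m1 r" unfolding r_def by (rule physical_solution[OF p(1,2)])
    show "(r \<longlongrightarrow> 0) (at_right 0)"
      unfolding r_def by (rule filterlim_compose[OF f_tendsto_0 tan_bot])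
    show "(r \<longlongrightarrow> (2 * real_of_int l + 1) * (pi / 2)) (at_left (pi / 2))"
      unfolding r_def by (rule filterlim_compose[OF l tan_top])
  qed
  moreover have "bij_betw (\<lambda>t. ln (tan t / p)) {t \<in> {0<..<pi / 2}. r t = pi / 2} (nodes p)"
  proof (rule bij_betw_byWitness[where f'="\<lambda>x. arctan (p * exp x)"])
    have tp: "tan t > 0" if "t \<in> {0<..<pi / 2}" for t using that by (auto intro: tan_gt_zero)
    show "\<forall>t\<in>{t \<in> {0<..<pi / 2}. r t = pi / 2}. arctan (p * exp (ln (tan t / p))) = t"
      using tp p(1) by (auto intro!: arctan_tan)
    show "\<forall>x\<in>nodes p. ln (tan (arctan (p * exp x)) / p) = x"
      using p(1) by (simp add: tan_arctan)
    show "(\<lambda>t. ln (tan t / p)) ` {t \<in> {0<..<pi / 2}. r t = pi / 2} \<subseteq> nodes p"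
      by (auto simp: nodes_def r_def)
    show "(\<lambda>x. arctan (p * exp x)) ` nodes p \<subseteq> {t \<in> {0<..<pi / 2}. r t = pi / 2}"
      using p(1) arctan_ubound by (auto simp: nodes_def r_def tan_arctan)
  qed
  then have "has_nodal_number r k"
    unfolding has_nodal_number_def using p(3,4) bij_betw_finite bij_betw_same_card by blast
  ultimately show ?thesis by blast
qed

end

theorem theoremA:
  fixes m0 m1 :: nat
  assumes "2 \<le> m0" and "m0 \<le> 5" and "m0 \<le> m1"
  shows "\<forall>k::nat. k \<ge> 1 \<longrightarrow> (\<exists>r. bvp_solution m0 m1 r \<and> has_nodal_number r k)"
proof -
  interpret join_bvp m0 m1 using assms by unfold_locales auto
  show ?thesis using solution_with_nodes by blast
qed

end
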